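(* Let $I_b=[0,\varepsilon]$ with logarithmic boundary at $r=0$, fix a scale $\lambda>0$ at $r=0$ and a smooth $\chi:[0,\varepsilon]\to[0,1]$ with $\chi(0)=0$, $\chi(\varepsilon)=1$, and let $p_\lambda,i_\chi,K_{\lambda,\chi}$ be as in the context. These maps define a special deformation retract $$\bigl(C^\bullet(I),d\bigr)\ \underset{p_\lambda}{\overset{i_\chi}{\rightleftarrows}}\ \bigl(\mathcal A_{\log,0}^\bullet(I_b),d_b\bigr),\qquad K_{\lambda,\chi},$$ i.e. $p_\lambda i_\chi=\mathrm{id}$, $d_bK_{\lambda,\chi}+K_{\lambda,\chi}d_b=\mathrm{id}-i_\chi p_\lambda$, and $K_{\lambda,\chi}^2=0$, $p_\lambda K_{\lambda,\chi}=0$, $K_{\lambda,\chi}i_\chi=0$. The endpoint maps commute with the retract, with the map at $0$ interpreted as $\mathrm{Reg}_0^\lambda$ and the map at $\varepsilon$ as ordinary evaluation.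
   Context: $\mathcal A_{\log,0}^\bullet(I_b)$ is the commutative dg algebra of logarithmic forms on $[0,\varepsilon]$ with logarithmic singularities only at $r=0$: degree $0$ consists of finite sums $\sum_jf_j(r)(\log r)^j$ and degree $1$ of finite sums $\sum_jf_j(r)(\log r)^j\frac{dr}{r}$ with $f_j\in C^\infty([0,\varepsilon])$ (viewed as functions/forms on $(0,\varepsilon]$); $d_b$ is the de Rham differential. The regularized restriction $\mathrm{Reg}^\lambda_0$ at $0$ is obtained from the expansion at $r=0$ by substituting $\log r=\log\lambda$ and $r=0$: $\mathrm{Reg}_0^\lambda(\sum f_j(\log r)^j)=\sum f_j(0)(\log\lambda)^j$ (and it kills 1-forms). For each 1-form $\eta$ there is a unique $\mathsf P_\lambda\eta\in\mathcal A^0_{\log,0}(I_b)$ with $d_b\mathsf P_\lambda\eta=\eta$ and $\mathrm{Reg}_0^\lambda(\mathsf P_\lambda\eta)=0$; the regularized integral is $\mathrm{Tr}^\lambda_{I_b}(\eta)=(\mathsf P_\lambda\eta)(\varepsilon)$, so that $\mathrm{Tr}_{I_b}^\lambda(d_bf)=f(\varepsilon)-\mathrm{Reg}_0^\lambda(f)$. $C^\bullet(I)$: basis $\epsilon_0,\epsilon_1$ in degree $0$, $\epsilon_{01}$ in degree $1$, $d\epsilon_0=-\epsilon_{01}$, $d\epsilon_1=\epsilon_{01}$. $p_\lambda(f)=\mathrm{Reg}_0^\lambda(f)\epsilon_0+f(\varepsilon)\epsilon_1$ on functions, $p_\lambda(\eta)=\mathrm{Tr}_{I_b}^\lambda(\eta)\epsilon_{01}$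 on 1-forms; $i_\chi(\epsilon_0)=1-\chi$, $i_\chi(\epsilon_1)=\chi$, $i_\chi(\epsilon_{01})=d\chi$; $K_{\lambda,\chi}\eta=\mathsf P_\lambda\eta-\chi\,\mathrm{Tr}_{I_b}^\lambda(\eta)$ on 1-forms and $K_{\lambda,\chi}=0$ on functions. (For collar applications $\chi$ is taken constant near both endpoints; this is not needed here.) *)

theory Defs
  imports "HOL-Analysis.Analysis" "HOL-Library.Function_Algebras"
begin

section \<open>Cochain complexes and special deformation retracts\<close>

text \<open>
  The homogeneous parts of a complex are subspaces of one ambient vector space.  All conditions
  below are imposed on homogeneous elements only, so the values of maps elsewhere are irrelevant.
\<close>

record ('k, 'v) cochain_complex =
  grade :: "int \<Rightarrow> 'v set"
  scl :: "'k \<Rightarrow> 'v \<Rightarrow> 'v"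
  diff :: "'v \<Rightarrow> 'v"

definition graded_linear ::
    "int \<Rightarrow> ('k, 'v::ab_group_add) cochain_complex \<Rightarrow> ('k, 'w::ab_group_add) cochain_complex
      \<Rightarrow> ('v \<Rightarrow> 'w) \<Rightarrow> bool" where
  "graded_linear k X Y f \<longleftrightarrow>
     (\<forall>n. \<forall>x\<in>grade X n. f x \<in> grade Y (n + k)) \<and>
     (\<forall>n. \<forall>x\<in>grade X n. \<forall>y\<in>grade X n. f (x + y) = f x + f y) \<and>
     (\<forall>n c. \<forall>x\<in>grade X n. f (scl X c x) = scl Y c (f x))"

definition is_cochain_complex :: "('k::field, 'v::ab_group_add) cochain_complex \<Rightarrow> bool" where
  "is_cochain_complex X \<longleftrightarrow>
     vector_space (scl X) \<and>
     (\<forall>n. module.subspace (scl X) (grade X n)) \<and>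
     graded_linear 1 X X (diff X) \<and>
     (\<forall>n. \<forall>x\<in>grade X n. diff X (diff X x) = 0)"

definition chain_map ::
    "('k, 'v::ab_group_add) cochain_complex \<Rightarrow> ('k, 'w::ab_group_add) cochain_complex
      \<Rightarrow> ('v \<Rightarrow> 'w) \<Rightarrow> bool" where
  "chain_map X Y f \<longleftrightarrow>
     graded_linear 0 X Y f \<and> (\<forall>n. \<forall>x\<in>grade X n. diff Y (f x) = f (diff X x))"

definition special_deformation_retract ::
    "('k::field, 's::ab_group_add) cochain_complex \<Rightarrow> ('k, 'v::ab_group_add) cochain_complex
      \<Rightarrow> ('s \<Rightarrow> 'v) \<Rightarrow> ('v \<Rightarrow> 's) \<Rightarrow> ('v \<Rightarrow> 'v) \<Rightarrow> bool" where
  "special_deformation_retract S A i p K \<longleftrightarrow>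
     is_cochain_complex S \<and> is_cochain_complex A \<and>
     chain_map S A i \<and> chain_map A S p \<and> graded_linear (-1) A A K \<and>
     (\<forall>n. \<forall>s\<in>grade S n. p (i s) = s) \<and>
     (\<forall>n. \<forall>x\<in>grade A n. diff A (K x) + K (diff A x) = x - i (p x)) \<and>
     (\<forall>n. \<forall>x\<in>grade A n. K (K x) = 0) \<and>
     (\<forall>n. \<forall>x\<in>grade A n. p (K x) = 0) \<and>
     (\<forall>n. \<forall>s\<in>grade S n. K (i s) = 0)"

text \<open>
  A pair of chain maps \<open>eS: S \<rightarrow> S'\<close> and \<open>eA: A \<rightarrow> A'\<close> that commutes with the structure maps
  \<open>(i, p, K)\<close> of a retract of \<open>A\<close> onto \<open>S\<close> and \<open>(i', p', K')\<close> of a retract of \<open>A'\<close> onto \<open>S'\<close>.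
\<close>

definition retract_morphism where
  "retract_morphism S A i p K S' A' i' p' K' eS eA \<longleftrightarrow>
     chain_map S S' eS \<and> chain_map A A' eA \<and>
     (\<forall>n. \<forall>s\<in>grade S n. eA (i s) = i' (eS s)) \<and>
     (\<forall>n. \<forall>x\<in>grade A n. eS (p x) = p' (eA x)) \<and>
     (\<forall>n. \<forall>x\<in>grade A n. eA (K x) = K' (eA x))"

text \<open>The complex with the ground field in degree 0, i.e. the forms on a point.\<close>

definition point_complex :: "('k::field, 'k) cochain_complex" where
  "point_complex =
     \<lparr>grade = (\<lambda>n. if n = 0 then UNIV else {0}), scl = (*), diff = (\<lambda>_. 0)\<rparr>"

text \<open>
  Compatibility of a retract with restriction to an endpoint, where the complex of the endpoint
  carries the trivial retract \<open>(id, id, 0)\<close>.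
\<close>

definition commutes_with_endpoint where
  "commutes_with_endpoint S A i p K eS eA \<longleftrightarrow>
     retract_morphism S A i p K point_complex point_complex id id (\<lambda>_. 0) eS eA"


section \<open>Cochains of the interval\<close>

text \<open>The element \<open>((a0, a1), a01)\<close> stands for \<open>a0 \<epsilon>\<^sub>0 + a1 \<epsilon>\<^sub>1 + a01 \<epsilon>\<^sub>0\<^sub>1\<close>.\<close>

definition interval_cochains :: "('k::field, ('k \<times> 'k) \<times> 'k) cochain_complex" where
  "interval_cochains =
     \<lparr>grade = (\<lambda>n. if n = 0 then UNIV \<times> {0} else if n = 1 then {0} \<times> UNIV else {0}),
      scl = (\<lambda>c ((a0, a1), a01). ((c * a0, c * a1), c * a01)),
      diff = (\<lambda>((a0, a1), a01). (0, a1 - a0))\<rparr>"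

definition cochain_at_0 :: "('k \<times> 'k) \<times> 'k \<Rightarrow> 'k" where
  "cochain_at_0 = (\<lambda>((a0, a1), a01). a0)"

definition cochain_at_1 :: "('k \<times> 'k) \<times> 'k \<Rightarrow> 'k" where
  "cochain_at_1 = (\<lambda>((a0, a1), a01). a1)"


section \<open>Logarithmic forms\<close>

text \<open>
  Coefficients are taken in a complete normed field \<open>'k\<close> over the reals, i.e. in the real or the
  complex numbers.  On a closed interval the derivatives are one-sided at the boundary points.
\<close>

definition smooth_on :: "real set \<Rightarrow> (real \<Rightarrow> 'k::real_normed_vector) \<Rightarrow> bool" where
  "smooth_on S f \<longleftrightarrow>
     (\<exists>D::nat \<Rightarrow> real \<Rightarrow> 'k. (\<forall>x\<in>S. D 0 x = f x) \<and>
        (\<forall>n. \<forall>x\<in>S. (D n has_vector_derivative D (Suc n) x) (at x within S)))"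

text \<open>
  Functions on \<open>(0, \<epsilon>]\<close> are represented by functions that vanish outside \<open>(0, \<epsilon>]\<close>, so that equality
  in HOL is equality on \<open>(0, \<epsilon>]\<close>.
\<close>

definition cut_off :: "real \<Rightarrow> (real \<Rightarrow> 'k::zero) \<Rightarrow> real \<Rightarrow> 'k" where
  "cut_off \<epsilon> f = (\<lambda>r. if r \<in> {0<..\<epsilon>} then f r else 0)"

definition log_expansion ::
    "real \<Rightarrow> nat \<Rightarrow> (nat \<Rightarrow> real \<Rightarrow> 'k::{real_normed_field,banach}) \<Rightarrow> (real \<Rightarrow> 'k) \<Rightarrow> bool" where
  "log_expansion \<epsilon> N F f \<longleftrightarrow>
     (\<forall>j\<le>N. smooth_on {0..\<epsilon>} (F j)) \<and>
     f = cut_off \<epsilon> (\<lambda>r. \<Sum>j\<le>N. F j r * of_real (ln r) ^ j)"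

definition log_functions :: "real \<Rightarrow> (real \<Rightarrow> 'k::{real_normed_field,banach}) set" where
  "log_functions \<epsilon> = {f. \<exists>N F. log_expansion \<epsilon> N F f}"

text \<open>
  A 1-form \<open>h(r) dr\<close> is represented by \<open>h\<close>; it is logarithmic iff \<open>r h(r)\<close>, its coefficient with
  respect to \<open>dr/r\<close>, is a logarithmic function.
\<close>

definition log_one_forms :: "real \<Rightarrow> (real \<Rightarrow> 'k::{real_normed_field,banach}) set" where
  "log_one_forms \<epsilon> = {h. \<exists>g\<in>log_functions \<epsilon>. h = (\<lambda>r. g r / of_real r)}"

definition de_rham :: "real \<Rightarrow> (real \<Rightarrow> 'k::real_normed_vector) \<Rightarrow> real \<Rightarrow> 'k" where
  "de_rham \<epsilon> f = cut_off \<epsilon> (\<lambda>r. vector_derivative f (at r within {0<..\<epsilon>}))"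

definition log_forms ::
    "real \<Rightarrow> ('k::{real_normed_field,banach}, (real \<Rightarrow> 'k) \<times> (real \<Rightarrow> 'k)) cochain_complex" where
  "log_forms \<epsilon> =
     \<lparr>grade = (\<lambda>n. if n = 0 then log_functions \<epsilon> \<times> {0}
                   else if n = 1 then {0} \<times> log_one_forms \<epsilon> else {0}),
      scl = (\<lambda>c (f, h). (\<lambda>r. c * f r, \<lambda>r. c * h r)),
      diff = (\<lambda>(f, h). (0, de_rham \<epsilon> f))\<rparr>"

text \<open>In the following, \<open>l\<close> is the scale \<open>\<lambda>\<close>.\<close>

definition Reg :: "real \<Rightarrow> real \<Rightarrow> (real \<Rightarrow> 'k::{real_normed_field,banach}) \<Rightarrow> 'k" where
  "Reg \<epsilon> l f =
     (THE c. \<exists>N F. log_expansion \<epsilon> N F f \<and> c = (\<Sum>j\<le>N. F j 0 * of_real (ln l) ^ j))"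

definition primitive ::
    "real \<Rightarrow> real \<Rightarrow> (real \<Rightarrow> 'k::{real_normed_field,banach}) \<Rightarrow> real \<Rightarrow> 'k" where
  "primitive \<epsilon> l h = (THE f. f \<in> log_functions \<epsilon> \<and> de_rham \<epsilon> f = h \<and> Reg \<epsilon> l f = 0)"

definition reg_integral ::
    "real \<Rightarrow> real \<Rightarrow> (real \<Rightarrow> 'k::{real_normed_field,banach}) \<Rightarrow> 'k" where
  "reg_integral \<epsilon> l h = primitive \<epsilon> l h \<epsilon>"

definition log_reg_0 ::
    "real \<Rightarrow> real \<Rightarrow> (real \<Rightarrow> 'k::{real_normed_field,banach}) \<times> (real \<Rightarrow> 'k) \<Rightarrow> 'k" where
  "log_reg_0 \<epsilon> l = (\<lambda>(f, h). Reg \<epsilon> l f)"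

definition log_eval_end :: "real \<Rightarrow> (real \<Rightarrow> 'k) \<times> (real \<Rightarrow> 'k) \<Rightarrow> 'k" where
  "log_eval_end \<epsilon> = (\<lambda>(f, h). f \<epsilon>)"


section \<open>The maps of the retract\<close>

definition retract_p ::
    "real \<Rightarrow> real \<Rightarrow> (real \<Rightarrow> 'k::{real_normed_field,banach}) \<times> (real \<Rightarrow> 'k) \<Rightarrow> ('k \<times> 'k) \<times> 'k" where
  "retract_p \<epsilon> l = (\<lambda>(f, h). ((Reg \<epsilon> l f, f \<epsilon>), reg_integral \<epsilon> l h))"

definition retract_i ::
    "real \<Rightarrow> (real \<Rightarrow> real) \<Rightarrow> ('k::{real_normed_field,banach} \<times> 'k) \<times> 'k
      \<Rightarrow> (real \<Rightarrow> 'k) \<times> (real \<Rightarrow> 'k)" where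
  "retract_i \<epsilon> chi = (\<lambda>((a0, a1), a01).
     (cut_off \<epsilon> (\<lambda>r. a0 * of_real (1 - chi r) + a1 * of_real (chi r)),
      \<lambda>r. a01 * de_rham \<epsilon> (\<lambda>s. of_real (chi s)) r))"

definition retract_K ::
    "real \<Rightarrow> real \<Rightarrow> (real \<Rightarrow> real) \<Rightarrow> (real \<Rightarrow> 'k::{real_normed_field,banach}) \<times> (real \<Rightarrow> 'k)
      \<Rightarrow> (real \<Rightarrow> 'k) \<times> (real \<Rightarrow> 'k)" where
  "retract_K \<epsilon> l chi = (\<lambda>(f, h).
     (primitive \<epsilon> l h - cut_off \<epsilon> (\<lambda>r. of_real (chi r) * reg_integral \<epsilon> l h), 0))"

end

theory Submission
  imports Defs
begin

text \<open>
  Hadamard's lemma \<open>f r = f 0 + r g r\<close> drives the analysis.  It makes \<open>Reg\<close> well defined: if an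
  expansion represents 0, then the polynomial in \<open>ln r\<close> whose coefficients are the values at
  \<open>r = 0\<close> tends to 0 as \<open>ln r\<close> tends to \<open>-\<infinity>\<close>, so it vanishes identically.  It
  also gives primitives: it splits \<open>G (ln r)^n dr/r\<close> into a constant multiple of \<open>(ln r)^n dr/r\<close>
  and a form \<open>H (ln r)^n dr\<close>, which is integrated by parts with the primitive \<open>r mean_integral H r\<close>
  of \<open>H\<close>; this lowers the power of the logarithm.  A function with zero differential is constant on
  \<open>(0, \<epsilon>]\<close> and hence equal to its regularized value at 0, so primitives with regularized
  value 0 are unique.  The retract identities then reduce to the linearity of \<open>Reg\<close> and \<open>primitive\<close>.
\<close>

section \<open>Closure properties of smooth functions\<close>

lemma smooth_onI:
  assumes "\<And>x. x \<in> S \<Longrightarrow> D 0 x = f x"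
    and "\<And>n x. x \<in> S \<Longrightarrow> (D n has_vector_derivative D (Suc n) x) (at x within S)"
  shows "smooth_on S f"
  using assms unfolding smooth_on_def by blast

text \<open>The derivative sequence in the definition starts with \<open>f\<close> only on
  \<open>S\<close>. Replacing its first member by \<open>f\<close> itself is harmless, because
  derivatives within \<open>S\<close> see only values on \<open>S\<close>; this gives a genuine
  equation \<open>D 0 = f\<close> to rewrite with.\<close>

lemma smooth_onE:
  assumes "smooth_on S f"
  obtains D where "D 0 = f"
    and "\<And>n x. x \<in> S \<Longrightarrow> (D n has_vector_derivative D (Suc n) x) (at x within S)"
proof -
  obtain D where D: "\<And>x. x \<in> S \<Longrightarrow> D 0 x = f x"
      "\<And>n x. x \<in> S \<Longrightarrow> (D n has_vector_derivative D (Suc n) x) (at x within S)"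
    using assms unfolding smooth_on_def by blast
  show ?thesis
  proof (rule that[of "D(0 := f)"])
    fix n x assume "x \<in> S"
    show "((D(0 := f)) n has_vector_derivative (D(0 := f)) (Suc n) x) (at x within S)"
      using D \<open>x \<in> S\<close>
      by (cases n) (auto intro: has_vector_derivative_transform[of x S f "D 0"])
  qed auto
qed

lemma smooth_on_deriv:
  assumes "smooth_on S f"
  obtains f' where "smooth_on S f'"
    and "\<And>x. x \<in> S \<Longrightarrow> (f has_vector_derivative f' x) (at x within S)"
proof -
  obtain D where D: "D 0 = f"
      "\<And>n x. x \<in> S \<Longrightarrow> (D n has_vector_derivative D (Suc n) x) (at x within S)"
    using smooth_onE[OF assms] by blast
  show ?thesis
  proof (rule that)
    show "smooth_on S (D 1)"
      by (rule smooth_onI[where D = "\<lambda>n. D (Suc n)"]) (use D(2) in auto)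
    show "(f has_vector_derivative D 1 x) (at x within S)" if "x \<in> S" for x
      using D(2)[OF that, of 0] D(1) by simp
  qed
qed

lemma smooth_on_imp_continuous_on: "smooth_on S f \<Longrightarrow> continuous_on S f"
  by (erule smooth_on_deriv) (rule continuous_on_vector_derivative)

lemma smooth_on_const: "smooth_on S (\<lambda>_. c)"
  by (rule smooth_onI[where D = "\<lambda>n _. if n = 0 then c else 0"]) auto

lemma smooth_on_bounded_linear:
  assumes L: "bounded_linear L" and "smooth_on S f"
  shows "smooth_on S (\<lambda>x. L (f x))"
proof -
  obtain D where D: "D 0 = f"
      "\<And>n x. x \<in> S \<Longrightarrow> (D n has_vector_derivative D (Suc n) x) (at x within S)"
    using smooth_onE[OF assms(2)] by blast
  show ?thesis
    by (rule smooth_onI[where D = "\<lambda>n x. L (D n x)"])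
      (use D in \<open>auto intro: bounded_linear.has_vector_derivative[OF L]\<close>)
qed

lemma smooth_on_add:
  assumes "smooth_on S f" "smooth_on S g"
  shows "smooth_on S (\<lambda>x. f x + g x)"
proof -
  obtain D where D: "D 0 = f"
      "\<And>n x. x \<in> S \<Longrightarrow> (D n has_vector_derivative D (Suc n) x) (at x within S)"
    using smooth_onE[OF assms(1)] by blast
  obtain E where E: "E 0 = g"
      "\<And>n x. x \<in> S \<Longrightarrow> (E n has_vector_derivative E (Suc n) x) (at x within S)"
    using smooth_onE[OF assms(2)] by blast
  show ?thesis
    by (rule smooth_onI[where D = "\<lambda>n x. D n x + E n x"])
      (use D E in \<open>auto intro: has_vector_derivative_add\<close>)
qed

lemma smooth_on_cmult:
  fixes f :: "real \<Rightarrow> 'k::real_normed_algebra"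
  shows "smooth_on S f \<Longrightarrow> smooth_on S (\<lambda>x. c * f x)"
  by (rule smooth_on_bounded_linear[OF bounded_linear_mult_right])

lemma smooth_on_of_real:
  "smooth_on S f \<Longrightarrow> smooth_on S (\<lambda>x. of_real (f x) :: 'k::real_normed_algebra_1)"
  by (rule smooth_on_bounded_linear[OF bounded_linear_of_real])

text \<open>By Leibniz, the n-th derivative of \<open>x f\<close> is \<open>x\<close> times the n-th
  derivative of \<open>f\<close> plus \<open>n\<close> times the previous one. For
  \<open>n = 0\<close> the truncated index \<open>n - 1\<close> is multiplied by 0. Factors of
  \<open>r\<close> arise both when a derivative is written as a multiple of \<open>dr/r\<close> and
  when primitives are built.\<close>

lemma smooth_on_ident_scaleR:
  assumes "smooth_on S f"
  shows "smooth_on S (\<lambda>x. x *\<^sub>R f x)"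
proof -
  obtain D where D: "D 0 = f"
      "\<And>n x. x \<in> S \<Longrightarrow> (D n has_vector_derivative D (Suc n) x) (at x within S)"
    using smooth_onE[OF assms(1)] by blast
  have *: "((\<lambda>x. x *\<^sub>R D n x + real n *\<^sub>R D (n - 1) x) has_vector_derivative
      x *\<^sub>R D (Suc n) x + real (Suc n) *\<^sub>R D n x) (at x within S)" if "x \<in> S" for n x
  proof (cases n)
    case 0
    then show ?thesis
      using has_vector_derivative_scaleR[OF DERIV_ident D(2)[OF that, of n]] by simp
  next
    case (Suc m)
    have "((\<lambda>x. real n *\<^sub>R D m x) has_vector_derivative real n *\<^sub>R D n x) (at x within S)"
      using bounded_linear.has_vector_derivative[OF bounded_linear_scaleR_right D(2)[OF that]] Suc
      by blast
    from has_vector_derivative_add[OF has_vector_derivative_scaleR[OF DERIV_ident D(2)[OF that, of n]] this]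
    show ?thesis using Suc by (simp add: algebra_simps scaleR_2)
  qed
  show ?thesis
    by (rule smooth_onI[where D = "\<lambda>n x. x *\<^sub>R D n x + real n *\<^sub>R D (n - 1) x"])
      (use D(1) * in auto)
qed

section \<open>Averages over \<open>[0, r]\<close> and Hadamard's lemma\<close>

text \<open>For \<open>r > 0\<close> and continuous \<open>f\<close> this is the average of
  \<open>f\<close> over \<open>[0, r]\<close>. Rescaling to the fixed interval \<open>[0, 1]\<close>
  avoids dividing by \<open>r\<close>, so that smoothness up to \<open>r = 0\<close> follows by
  differentiating under the integral sign.\<close>

definition mean_integral :: "(real \<Rightarrow> 'a::banach) \<Rightarrow> real \<Rightarrow> 'a" where
  "mean_integral f r = integral {0..1} (\<lambda>t. f (t * r))"

lemma has_vector_derivative_rescale: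
  fixes f :: "real \<Rightarrow> 'a::real_normed_vector"
  assumes f: "\<And>x. x \<in> {0..e} \<Longrightarrow> (f has_vector_derivative f' x) (at x within {0..e})"
    and "t \<in> {0..1}" "r \<in> {0..e}"
  shows "((\<lambda>r. f (t * r)) has_vector_derivative t *\<^sub>R f' (t * r)) (at r within {0..e})"
    and "((\<lambda>t. f (t * r)) has_vector_derivative r *\<^sub>R f' (t * r)) (at t within {0..1})"
proof -
  have mem: "s * x \<in> {0..e}" if "s \<in> {0..1}" "x \<in> {0..e}" for s x
    using that mult_mono[of s 1 x e] by auto
  have *: "(f has_vector_derivative f' (t * r)) (at (t * r) within T)" if "T \<subseteq> {0..e}" for T
    using f[OF mem[OF assms(2,3)]] that by (rule has_vector_derivative_within_subset)
  have "((f \<circ> (\<lambda>r. t * r)) has_vector_derivative t *\<^sub>R f' (t * r)) (at r within {0..e})"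
    by (rule vector_diff_chain_within, auto intro!: derivative_eq_intros *)
      (use mem assms in auto)
  then show "((\<lambda>r. f (t * r)) has_vector_derivative t *\<^sub>R f' (t * r)) (at r within {0..e})"
    by (simp add: o_def)
  have "((f \<circ> (\<lambda>t. t * r)) has_vector_derivative r *\<^sub>R f' (t * r)) (at t within {0..1})"
    by (rule vector_diff_chain_within, auto intro!: derivative_eq_intros *)
      (use mem assms in auto)
  then show "((\<lambda>t. f (t * r)) has_vector_derivative r *\<^sub>R f' (t * r)) (at t within {0..1})"
    by (simp add: o_def)
qed

lemma continuous_on_rescale:
  fixes f :: "real \<Rightarrow> 'a::real_normed_vector"
  assumes "continuous_on {0..e} f"
  shows "continuous_on ({0..e} \<times> {0..1}) (\<lambda>(r, t). f (t * r))"
  unfolding split_beta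
proof (rule continuous_on_compose2[OF assms])
  show "(\<lambda>x. snd x * fst x) ` ({0..e} \<times> {0..1}) \<subseteq> {0..e}"
  proof clarify
    fix r t :: real assume "r \<in> {0..e}" "t \<in> {0..1}"
    then show "snd (r, t) * fst (r, t) \<in> {0..e}" using mult_mono[of t 1 r e] by auto
  qed
qed (intro continuous_intros)

text \<open>Differentiation under the integral sign: each derivative in \<open>r\<close> brings out
  one factor \<open>t\<close> by the chain rule. Carrying the weight \<open>t ^ n\<close> makes the
  statement iterable, which yields all derivatives of \<open>mean_integral f\<close>.\<close>

lemma has_vector_derivative_integral_rescale:
  fixes f :: "real \<Rightarrow> 'a::banach"
  assumes f: "\<And>x. x \<in> {0..e} \<Longrightarrow> (f has_vector_derivative f' x) (at x within {0..e})"
    and f': "continuous_on {0..e} f'" and r: "r \<in> {0..e}"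
  shows "((\<lambda>r. integral {0..1} (\<lambda>t. t ^ n *\<^sub>R f (t * r))) has_vector_derivative
    integral {0..1} (\<lambda>t. t ^ Suc n *\<^sub>R f' (t * r))) (at r within {0..e})"
proof -
  have cf: "continuous_on {0..e} f"
    using f by (rule continuous_on_vector_derivative)
  have "((\<lambda>r. integral (cbox 0 1) (\<lambda>t. t ^ n *\<^sub>R f (t * r))) has_vector_derivative
    integral (cbox 0 1) (\<lambda>t. t ^ Suc n *\<^sub>R f' (t * r))) (at r within {0..e})"
  proof (rule leibniz_rule_vector_derivative[where
        f = "\<lambda>r t. t ^ n *\<^sub>R f (t * r)" and fx = "\<lambda>r t. t ^ Suc n *\<^sub>R f' (t * r)"])
    fix x t :: real assume x: "x \<in> {0..e}" and "t \<in> cbox 0 1"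
    then show "((\<lambda>x. t ^ n *\<^sub>R f (t * x)) has_vector_derivative t ^ Suc n *\<^sub>R f' (t * x))
        (at x within {0..e})"
      using bounded_linear.has_vector_derivative[OF bounded_linear_scaleR_right
          has_vector_derivative_rescale(1)[OF f], of t x "t ^ n"]
      by (simp add: mult.commute)
  next
    fix x :: real assume x: "x \<in> {0..e}"
    have "continuous_on {0..1} (\<lambda>t. f (t * x))"
      by (rule continuous_on_compose2[OF continuous_on_rescale[OF cf], of _ "\<lambda>t. (x, t)", simplified])
        (use x in \<open>auto intro!: continuous_intros\<close>)
    then show "(\<lambda>t. t ^ n *\<^sub>R f (t * x)) integrable_on cbox 0 1"
      by (auto intro!: integrable_continuous_real continuous_intros)
  next
    show "continuous_on ({0..e} \<times> cbox 0 1) (\<lambda>(r, t). t ^ Suc n *\<^sub>R f' (t * r))"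
      using continuous_on_rescale[OF f'] unfolding split_beta
      by (auto intro!: continuous_intros)
  qed (use r in auto)
  then show ?thesis by simp
qed

lemma smooth_on_mean_integral:
  fixes f :: "real \<Rightarrow> 'a::banach"
  assumes "smooth_on {0..e} f"
  shows "smooth_on {0..e} (mean_integral f)"
proof -
  obtain D where D: "D 0 = f"
      "\<And>n x. x \<in> {0..e} \<Longrightarrow> (D n has_vector_derivative D (Suc n) x) (at x within {0..e})"
    using smooth_onE[OF assms(1)] by blast
  show ?thesis
  proof (rule smooth_onI[where D = "\<lambda>n r. integral {0..1} (\<lambda>t. t ^ n *\<^sub>R D n (t * r))"])
    show "integral {0..1} (\<lambda>t. t ^ 0 *\<^sub>R D 0 (t * x)) = mean_integral f x" for x
      by (simp add: mean_integral_def D(1))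
    fix n x assume "x \<in> {0..e}"
    then show "((\<lambda>r. integral {0..1} (\<lambda>t. t ^ n *\<^sub>R D n (t * r))) has_vector_derivative
        integral {0..1} (\<lambda>t. t ^ Suc n *\<^sub>R D (Suc n) (t * x))) (at x within {0..e})"
      by (intro has_vector_derivative_integral_rescale D(2) continuous_on_vector_derivative[OF D(2)])
  qed
qed

text \<open>Integrating the \<open>t\<close>-derivative of \<open>t f(t r)\<close> over
  \<open>[0, 1]\<close> gives \<open>f r\<close> as the mean of \<open>f\<close> plus
  \<open>r\<close> times the derivative of that mean, which is exactly the product rule for
  \<open>r mean_integral f r\<close>. Nothing is divided by \<open>r\<close>, so the endpoint 0
  needs no separate treatment.\<close>

lemma has_vector_derivative_mean_integral:
  fixes f :: "real \<Rightarrow> 'a::banach"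
  assumes "smooth_on {0..e} f" and r: "r \<in> {0..e}"
  shows "((\<lambda>r. r *\<^sub>R mean_integral f r) has_vector_derivative f r) (at r within {0..e})"
proof -
  obtain f' where f': "smooth_on {0..e} f'"
    and df: "\<And>x. x \<in> {0..e} \<Longrightarrow> (f has_vector_derivative f' x) (at x within {0..e})"
    using smooth_on_deriv[OF assms(1)] by blast
  have int: "(\<lambda>t. t ^ n *\<^sub>R g (t * r)) integrable_on {0..1}"
    if "smooth_on {0..e} g" for n and g :: "real \<Rightarrow> 'a"
  proof -
    have "continuous_on {0..1} (\<lambda>t. g (t * r))"
      by (rule continuous_on_compose2[OF continuous_on_rescale[OF smooth_on_imp_continuous_on[OF that]],
            of _ "\<lambda>t. (r, t)", simplified])
        (use r in \<open>auto intro!: continuous_intros\<close>)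
    then show ?thesis by (auto intro!: integrable_continuous_real continuous_intros)
  qed
  have "((\<lambda>t. t *\<^sub>R r *\<^sub>R f' (t * r) + 1 *\<^sub>R f (t * r)) has_integral (1 *\<^sub>R f (1 * r) - 0 *\<^sub>R f (0 * r))) {0..1}"
  proof (rule fundamental_theorem_of_calculus)
    fix t :: real assume "t \<in> {0..1}"
    from has_vector_derivative_scaleR[OF DERIV_ident has_vector_derivative_rescale(2)[OF df this r]]
    show "((\<lambda>t. t *\<^sub>R f (t * r)) has_vector_derivative
        t *\<^sub>R r *\<^sub>R f' (t * r) + 1 *\<^sub>R f (t * r)) (at t within {0..1})" .
  qed simp
  moreover have "((\<lambda>t. r *\<^sub>R (t *\<^sub>R f' (t * r)) + f (t * r)) has_integral
      r *\<^sub>R integral {0..1} (\<lambda>t. t *\<^sub>R f' (t * r)) + integral {0..1} (\<lambda>t. f (t * r))) {0..1}"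
    using int[OF f', of 1] int[OF assms(1), of 0]
    by (intro has_integral_add has_integral_cmul integrable_integral) auto
  ultimately have eq: "r *\<^sub>R integral {0..1} (\<lambda>t. t *\<^sub>R f' (t * r)) + integral {0..1} (\<lambda>t. f (t * r)) = f r"
    by (simp add: mult.commute has_integral_unique)
  have "(mean_integral f has_vector_derivative integral {0..1} (\<lambda>t. t *\<^sub>R f' (t * r)))
      (at r within {0..e})"
    using has_vector_derivative_integral_rescale[OF df smooth_on_imp_continuous_on[OF f'] r, where n=0]
    by (simp add: mean_integral_def[abs_def])
  from has_vector_derivative_scaleR[OF DERIV_ident this] eq
  show ?thesis by (simp add: mean_integral_def)
qed

text \<open>The quotient is the mean of \<open>f'\<close>: since \<open>r mean_integral f' r\<close>
  is a primitive of \<open>f'\<close>, it differs from \<open>f\<close> by a constant, and that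
  constant is \<open>f 0\<close>.\<close>

lemma smooth_on_hadamard:
  fixes f :: "real \<Rightarrow> 'a::banach"
  assumes "smooth_on {0..e} f"
  obtains g where "smooth_on {0..e} g" "\<And>r. r \<in> {0..e} \<Longrightarrow> f r = f 0 + r *\<^sub>R g r"
proof -
  obtain f' where f': "smooth_on {0..e} f'"
    and df: "\<And>x. x \<in> {0..e} \<Longrightarrow> (f has_vector_derivative f' x) (at x within {0..e})"
    using smooth_on_deriv[OF assms(1)] by blast
  have "((\<lambda>r. f r - r *\<^sub>R mean_integral f' r) has_vector_derivative 0) (at r within {0..e})"
    if "r \<in> {0..e}" for r
    using has_vector_derivative_diff[OF df[OF that] has_vector_derivative_mean_integral[OF f' that]]
    by simp
  then obtain c where c: "\<And>r. r \<in> {0..e} \<Longrightarrow> f r - r *\<^sub>R mean_integral f' r = c"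
    using has_vector_derivative_zero_constant[OF convex_real_interval(5)] by blast
  have "f r = f 0 + r *\<^sub>R mean_integral f' r" if "r \<in> {0..e}" for r
    using c[OF that] c[of 0] that by (auto simp: algebra_simps)
  with smooth_on_mean_integral[OF f'] show ?thesis by (rule that)
qed

section \<open>Uniqueness of the boundary values in a logarithmic expansion\<close>

lemma log_zero_expansion:
  fixes F :: "nat \<Rightarrow> real \<Rightarrow> 'k::{real_normed_field,banach}"
  assumes e: "e > 0" and F: "\<And>j. j \<le> N \<Longrightarrow> smooth_on {0..e} (F j)"
    and 0: "\<And>r. r \<in> {0<..e} \<Longrightarrow> (\<Sum>j\<le>N. F j r * of_real (ln r) ^ j) = 0"
    and "j \<le> N"
  shows "F j 0 = 0"
proof -
  have "\<exists>g. smooth_on {0..e} g \<and> (\<forall>r\<in>{0..e}. F j r = F j 0 + r *\<^sub>R g r)" if "j \<le> N" for j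
    by (rule smooth_on_hadamard[OF F[OF that]]) blast
  then have "\<exists>G. \<forall>j. j \<le> N \<longrightarrow> smooth_on {0..e} (G j) \<and> (\<forall>r\<in>{0..e}. F j r = F j 0 + r *\<^sub>R G j r)"
    by (intro choice) blast
  then obtain G where G: "\<And>j. j \<le> N \<Longrightarrow> smooth_on {0..e} (G j)"
    "\<And>j r. j \<le> N \<Longrightarrow> r \<in> {0..e} \<Longrightarrow> F j r = F j 0 + r *\<^sub>R G j r" by blast
  define P where "P z = (\<Sum>j\<le>N. F j 0 * z ^ j)" for z
  \<comment> \<open>With \<open>x = - ln r\<close>, which tends to infinity, this is up to sign the
    decay of \<open>x ^ j / exp x\<close>.\<close>
  have logs: "((\<lambda>r. r * ln r ^ j) \<longlongrightarrow> 0) (at_right (0::real))" for j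
  proof -
    have "((\<lambda>r. (-1)^j * ((- ln r) ^ j / exp (- ln r))) \<longlongrightarrow> (-1)^j * 0) (at_right (0::real))"
      by (intro tendsto_mult tendsto_const filterlim_compose[OF tendsto_power_div_exp_0])
        (simp add: filterlim_uminus_at_top ln_at_0)
    moreover have "\<forall>\<^sub>F r in at_right (0::real). (-1)^j * ((- ln r) ^ j / exp (- ln r)) = r * ln r ^ j"
      using eventually_at_right_less[of 0]
    proof eventually_elim
      case (elim r)
      have "(-1) ^ j * (- ln r) ^ j = ln r ^ j" by (simp flip: power_mult_distrib)
      moreover have "exp (- ln r) = inverse r" using elim by (simp add: exp_minus)
      ultimately show ?case by (simp add: divide_inverse mult_ac)
    qed
    ultimately show ?thesis by (simp add: filterlim_cong)
  qed
  have sub: "\<forall>\<^sub>F r in at_right 0. r \<in> {0<..e}"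
    using e eventually_at_right_real[of 0 e] by (auto elim: eventually_mono)
  \<comment> \<open>The Hadamard remainders \<open>r G j r\<close>, multiplied by powers of
    \<open>ln r\<close>, vanish in the limit. Solving the relation \<open>0\<close> for the
    remaining part shows that they equal \<open>- P (ln r)\<close>.\<close>
  have "((\<lambda>r. - (\<Sum>j\<le>N. G j r * of_real (r * ln r ^ j))) \<longlongrightarrow> - (\<Sum>j\<le>N. G j 0 * of_real 0)) (at_right 0)"
  proof (intro tendsto_minus tendsto_sum tendsto_mult tendsto_of_real logs)
    fix j assume "j \<in> {..N}"
    then have "(G j \<longlongrightarrow> G j 0) (at 0 within {0..e})"
      using smooth_on_imp_continuous_on[OF G(1), of j] e by (simp add: continuous_on_def)
    then show "(G j \<longlongrightarrow> G j 0) (at_right 0)"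
      using e by (simp add: at_within_Icc_at_right)
  qed
  moreover have "\<forall>\<^sub>F r in at_right 0. - (\<Sum>j\<le>N. G j r * of_real (r * ln r ^ j)) = P (of_real (ln r))"
    using sub
  proof eventually_elim
    case (elim r)
    have "0 = (\<Sum>j\<le>N. (F j 0 + r *\<^sub>R G j r) * of_real (ln r) ^ j)"
      unfolding 0[OF elim, symmetric] using elim
      by (intro sum.cong refl arg_cong2[where f = "(*)"] G(2)) auto
    also have "\<dots> = P (of_real (ln r)) + (\<Sum>j\<le>N. G j r * of_real (r * ln r ^ j))"
      by (simp add: P_def sum.distrib algebra_simps scaleR_conv_of_real)
    finally show ?case by (simp add: eq_neg_iff_add_eq_0 neg_eq_iff_add_eq_0 add.commute)
  qed
  ultimately have lim: "((\<lambda>r. P (of_real (ln r))) \<longlongrightarrow> 0) (at_right 0)"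
    by (simp add: filterlim_cong)
  have "filterlim (\<lambda>r. of_real (ln r) :: 'k) at_infinity (at_right 0)"
    using filterlim_at_bot_imp_at_infinity[OF ln_at_0]
    by (simp add: filterlim_at_infinity_conv_norm_at_top)
  \<comment> \<open>A polynomial with a nonzero coefficient in positive degree has norm at least 1
    near infinity, which contradicts the limit 0 along \<open>ln r\<close>. Hence \<open>P\<close>
    is constant, and the same limit then forces its constant term to vanish.\<close>
  have nz: "F k 0 = 0" if "k \<noteq> 0" "k \<le> N" for k
  proof (rule ccontr)
    assume "F k 0 \<noteq> 0"
    then have "\<forall>\<^sub>F z in at_infinity. norm (P z) \<ge> 1"
      unfolding P_def using that by (intro polyfun_extremal) blast
    then have "\<forall>\<^sub>F r in at_right 0. norm (P (of_real (ln r))) \<ge> 1"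
      using \<open>filterlim _ at_infinity _\<close> by (auto simp: filterlim_iff)
    moreover have "\<forall>\<^sub>F r in at_right 0. norm (P (of_real (ln r))) < 1"
      using tendstoD[OF lim, of 1] by simp
    ultimately have "\<forall>\<^sub>F r in at_right (0::real). False" by eventually_elim simp
    then show False by simp
  qed
  have "P z = F 0 0" for z
    unfolding P_def using nz by (subst sum.remove[of _ 0]) (auto intro!: sum.neutral)
  then have "F 0 0 = 0" using lim by (simp add: tendsto_const_iff)
  with nz \<open>j \<le> N\<close> show ?thesis by (cases "j = 0") auto
qed

section \<open>The vector space of logarithmic functions\<close>

lemma has_vector_derivative_plus:
  assumes "(f has_vector_derivative D) F" "(g has_vector_derivative E) F"
  shows "(f + g has_vector_derivative D + E) F"
  unfolding func_plus using assms by (rule has_vector_derivative_add)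

text \<open>This is the shape in which the additive case arises in the inductions for derivatives
  and for primitives, where one side is a coefficient of \<open>dr/r\<close>.\<close>

lemma has_vector_derivative_plus_divide:
  fixes D E :: "'a \<Rightarrow> 'b::real_normed_field"
  assumes "(f has_vector_derivative D r / c) F" "(g has_vector_derivative E r / c) F"
  shows "(f + g has_vector_derivative (D + E) r / c) F"
  using has_vector_derivative_plus[OF assms] by (simp only: add_divide_distrib plus_fun_apply[of D])

lemma cut_off_simps:
  "r \<in> {0<..\<epsilon>} \<Longrightarrow> cut_off \<epsilon> f r = f r"
  "r \<notin> {0<..\<epsilon>} \<Longrightarrow> cut_off \<epsilon> f r = 0"
  by (auto simp: cut_off_def)

text \<open>The shorter expansion is padded with zero coefficients. The identity is stated for
  arbitrary \<open>z\<close>, since it is used both with \<open>z = ln r\<close> for the function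
  and with \<open>z = ln l\<close> for its regularized value.\<close>

lemma log_expansion_add:
  assumes "log_expansion \<epsilon> N F f" "log_expansion \<epsilon> M G g"
  obtains L H where "log_expansion \<epsilon> L H (f + g)"
    and "\<And>r z. (\<Sum>j\<le>L. H j r * z ^ j) = (\<Sum>j\<le>N. F j r * z ^ j) + (\<Sum>j\<le>M. G j r * z ^ j)"
proof -
  define H where "H j r = (if j \<le> N then F j r else 0) + (if j \<le> M then G j r else 0)" for j r
  have pad: "(\<Sum>j\<le>max N M. (if j \<le> K then a j else 0) * z ^ j) = (\<Sum>j\<le>K. a j * z ^ j)"
    if "K \<le> max N M" for K z and a :: "nat \<Rightarrow> 'a"
    using that by (intro sum.mono_neutral_cong_right) auto
  have sum: "(\<Sum>j\<le>max N M. H j r * z ^ j) = (\<Sum>j\<le>N. F j r * z ^ j) + (\<Sum>j\<le>M. G j r * z ^ j)" for r z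
    by (simp add: H_def distrib_right sum.distrib pad)
  have "smooth_on {0..\<epsilon>} (H j)" for j
    unfolding H_def[abs_def] using assms
    by (cases "j \<le> N"; cases "j \<le> M") (auto simp: log_expansion_def intro: smooth_on_add smooth_on_const)
  then have "log_expansion \<epsilon> (max N M) H (f + g)"
    using assms sum by (auto simp: log_expansion_def cut_off_def fun_eq_iff)
  with sum show ?thesis using that by blast
qed

lemma log_expansion_cmult:
  assumes "log_expansion \<epsilon> N F f"
  shows "log_expansion \<epsilon> N (\<lambda>j r. c * F j r) (\<lambda>r. c * f r)"
  using assms
  by (auto simp: log_expansion_def cut_off_def fun_eq_iff sum_distrib_left mult.assoc smooth_on_cmult)

lemma log_expansion_monomial:
  assumes "smooth_on {0..\<epsilon>} F"
  shows "log_expansion \<epsilon> n (\<lambda>j. if j = n then F else (\<lambda>_. 0)) (cut_off \<epsilon> (\<lambda>r. F r * of_real (ln r) ^ n))"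
proof -
  have "(\<Sum>j\<le>n. (if j = n then F else (\<lambda>_. 0)) r * of_real (ln r) ^ j) = F r * of_real (ln r) ^ n" for r
    by (subst sum.remove[of _ n]) (auto intro!: sum.neutral)
  then show ?thesis
    using assms by (auto simp: log_expansion_def smooth_on_const)
qed

lemma log_functions_monomial:
  "smooth_on {0..\<epsilon>} F \<Longrightarrow> cut_off \<epsilon> (\<lambda>r. F r * of_real (ln r) ^ n) \<in> log_functions \<epsilon>"
  using log_expansion_monomial unfolding log_functions_def by blast

lemma log_functions_smooth: "smooth_on {0..\<epsilon>} F \<Longrightarrow> cut_off \<epsilon> F \<in> log_functions \<epsilon>"
  using log_functions_monomial[of \<epsilon> F 0] by simp

lemma log_functions_add: "f \<in> log_functions \<epsilon> \<Longrightarrow> g \<in> log_functions \<epsilon> \<Longrightarrow> f + g \<in> log_functions \<epsilon>"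
  unfolding log_functions_def mem_Collect_eq by (elim exE, erule log_expansion_add) blast+

lemma log_functions_cmult: "f \<in> log_functions \<epsilon> \<Longrightarrow> (\<lambda>r. c * f r) \<in> log_functions \<epsilon>"
  unfolding log_functions_def by (auto intro: log_expansion_cmult)

text \<open>Reduces every rule for differences to the rules for sums and scalar multiples.\<close>

lemma diff_eq_add_cmult: "f - g = f + (\<lambda>r. - 1 * g r)" for f g :: "'a \<Rightarrow> 'b::ring_1"
  by (auto simp: fun_eq_iff)

lemma log_functions_diff: "f \<in> log_functions \<epsilon> \<Longrightarrow> g \<in> log_functions \<epsilon> \<Longrightarrow> f - g \<in> log_functions \<epsilon>"
  by (simp only: diff_eq_add_cmult log_functions_add log_functions_cmult)

lemma log_functions_0: "0 \<in> log_functions \<epsilon>"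
  using log_functions_smooth[OF smooth_on_const, of \<epsilon> 0] by (simp add: cut_off_def zero_fun_def)

lemma log_functions_outside: "f \<in> log_functions \<epsilon> \<Longrightarrow> r \<notin> {0<..\<epsilon>} \<Longrightarrow> f r = 0"
  unfolding log_functions_def log_expansion_def by (auto simp: cut_off_def)

text \<open>Logarithmic functions are finite sums of terms \<open>F (ln r) ^ n\<close>, so additive
  claims need only be checked on one such term. The proof adds the terms of an expansion one at a
  time.\<close>

lemma log_functions_induct [consumes 1, case_names monomial add]:
  assumes f: "f \<in> log_functions \<epsilon>"
    and mono: "\<And>F n. smooth_on {0..\<epsilon>} F \<Longrightarrow> P (cut_off \<epsilon> (\<lambda>r. F r * of_real (ln r) ^ n))"
    and add: "\<And>f g. P f \<Longrightarrow> P g \<Longrightarrow> P (f + g)"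
  shows "P f"
proof -
  obtain N F where F: "\<And>j. j \<le> N \<Longrightarrow> smooth_on {0..\<epsilon>} (F j)"
      and f: "f = cut_off \<epsilon> (\<lambda>r. \<Sum>j\<le>N. F j r * of_real (ln r) ^ j)"
    using f unfolding log_functions_def log_expansion_def by blast
  have "P (cut_off \<epsilon> (\<lambda>r. \<Sum>j\<le>n. F j r * of_real (ln r) ^ j))" if "n \<le> N" for n
    using that
  proof (induction n)
    case 0
    show ?case using mono[OF F, of 0 0] by simp
  next
    case (Suc n)
    have "cut_off \<epsilon> (\<lambda>r. \<Sum>j\<le>Suc n. F j r * of_real (ln r) ^ j) =
        cut_off \<epsilon> (\<lambda>r. \<Sum>j\<le>n. F j r * of_real (ln r) ^ j)
        + cut_off \<epsilon> (\<lambda>r. F (Suc n) r * of_real (ln r) ^ Suc n)"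
      by (auto simp: cut_off_def fun_eq_iff)
    then show ?case using Suc by (simp only: add mono F Suc_leD)
  qed
  with f show ?thesis by blast
qed

section \<open>Regularized restriction at 0\<close>

context
  fixes \<epsilon> l :: real
  assumes eps: "\<epsilon> > 0"
begin

text \<open>The difference of two expansions of \<open>f\<close> expands 0, so by
  \<open>log_zero_expansion\<close> all its coefficients vanish at \<open>r = 0\<close>. The two
  polynomials in the logarithm therefore agree at \<open>ln l\<close>, and the description defining
  \<open>Reg\<close> is unique.\<close>

lemma Reg_eqI:
  assumes "log_expansion \<epsilon> N F f"
  shows "Reg \<epsilon> l f = (\<Sum>j\<le>N. F j 0 * of_real (ln l) ^ j)"
  unfolding Reg_def
proof (rule the_equality)
  fix c assume "\<exists>N F. log_expansion \<epsilon> N F f \<and> c = (\<Sum>j\<le>N. F j 0 * of_real (ln l) ^ j)"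
  then obtain M G where G: "log_expansion \<epsilon> M G f" and c: "c = (\<Sum>j\<le>M. G j 0 * of_real (ln l) ^ j)"
    by blast
  obtain L H where H: "log_expansion \<epsilon> L H (f + (\<lambda>r. - 1 * f r))"
    and sum: "\<And>r z. (\<Sum>j\<le>L. H j r * z ^ j) = (\<Sum>j\<le>M. G j r * z ^ j) + (\<Sum>j\<le>N. - 1 * F j r * z ^ j)"
    by (rule log_expansion_add[OF G log_expansion_cmult[OF assms, of "- 1"]]) (rule that)
  have "cut_off \<epsilon> (\<lambda>r. \<Sum>j\<le>L. H j r * of_real (ln r) ^ j) = (\<lambda>_. 0)"
    using H by (auto simp: log_expansion_def fun_eq_iff)
  then have "(\<Sum>j\<le>L. H j r * of_real (ln r) ^ j) = 0" if "r \<in> {0<..\<epsilon>}" for r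
    using that by (subst cut_off_simps(1)[OF that, symmetric]) simp
  then have "H j 0 = 0" if "j \<le> L" for j
    using log_zero_expansion[OF eps, of L H] H that by (auto simp: log_expansion_def)
  then have "(\<Sum>j\<le>L. H j 0 * of_real (ln l) ^ j) = 0" by simp
  then show "c = (\<Sum>j\<le>N. F j 0 * of_real (ln l) ^ j)"
    unfolding sum c by (simp add: sum_negf)
qed (rule exI[of _ N], rule exI[of _ F], simp only: assms)

lemma Reg_add:
  assumes "f \<in> log_functions \<epsilon>" "g \<in> log_functions \<epsilon>"
  shows "Reg \<epsilon> l (f + g) = Reg \<epsilon> l f + Reg \<epsilon> l g"
proof -
  obtain N F M G where FG: "log_expansion \<epsilon> N F f" "log_expansion \<epsilon> M G g"
    using assms unfolding log_functions_def by blast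
  show ?thesis
    by (rule log_expansion_add[OF FG]) (simp add: Reg_eqI Reg_eqI[OF FG(1)] Reg_eqI[OF FG(2)])
qed

lemma Reg_cmult:
  assumes "f \<in> log_functions \<epsilon>"
  shows "Reg \<epsilon> l (\<lambda>r. c * f r) = c * Reg \<epsilon> l f"
proof -
  obtain N F where F: "log_expansion \<epsilon> N F f"
    using assms unfolding log_functions_def by blast
  show ?thesis
    using Reg_eqI[OF log_expansion_cmult[OF F]] Reg_eqI[OF F] by (simp add: sum_distrib_left mult.assoc)
qed

lemma Reg_diff:
  assumes "f \<in> log_functions \<epsilon>" "g \<in> log_functions \<epsilon>"
  shows "Reg \<epsilon> l (f - g) = Reg \<epsilon> l f - Reg \<epsilon> l g"
  unfolding diff_eq_add_cmult using assms
  using Reg_cmult[of g "- 1"] by (simp only: Reg_add log_functions_cmult) simp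

lemma Reg_smooth:
  assumes "smooth_on {0..\<epsilon>} F"
  shows "Reg \<epsilon> l (cut_off \<epsilon> F) = F 0"
  using Reg_eqI[OF log_expansion_monomial[OF assms, of 0]] by simp

lemma Reg_0: "Reg \<epsilon> l 0 = 0"
  using Reg_smooth[OF smooth_on_const, of 0] by (simp add: cut_off_def zero_fun_def)

section \<open>The de Rham differential on logarithmic functions\<close>

lemma de_rham_eqI:
  assumes "\<And>r. r \<in> {0<..\<epsilon>} \<Longrightarrow> (f has_vector_derivative g r) (at r within {0<..\<epsilon>})"
  shows "de_rham \<epsilon> f = cut_off \<epsilon> g"
proof -
  have "vector_derivative f (at r within {0<..\<epsilon>}) = g r" if "r \<in> {0<..\<epsilon>}" for r
  proof (rule vector_derivative_within[OF _ assms[OF that]])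
    \<comment> \<open>Derivatives within a set are unique only at its limit points. A connected set
      with more than one point consists of limit points, and \<epsilon> and \<epsilon>/2 are two
      points here.\<close>
    have "{0<..\<epsilon>} \<noteq> {x}" for x
    proof
      assume *: "{0<..\<epsilon>} = {x}"
      have "\<epsilon> \<in> {0<..\<epsilon>}" "\<epsilon> / 2 \<in> {0<..\<epsilon>}" using eps by auto
      then show False using eps unfolding * by simp
    qed
    then have "r islimpt {0<..\<epsilon>}"
      using that by (intro connected_imp_perfect) auto
    then show "at r within {0<..\<epsilon>} \<noteq> bot"
      by (simp add: trivial_limit_within)
  qed
  then show ?thesis by (auto simp: de_rham_def cut_off_def fun_eq_iff)
qed

text \<open>No differentiability is assumed: both functions have the same derivatives within
  \<open>(0, \<epsilon>]\<close>, so the choice inside \<open>vector_derivative\<close> returns the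
  same value.\<close>

lemma de_rham_cut_off: "de_rham \<epsilon> (cut_off \<epsilon> f) = de_rham \<epsilon> f"
proof -
  have "(cut_off \<epsilon> f has_vector_derivative D) (at r within {0<..\<epsilon>}) \<longleftrightarrow>
      (f has_vector_derivative D) (at r within {0<..\<epsilon>})" if "r \<in> {0<..\<epsilon>}" for r D
    by (rule iffI; erule has_vector_derivative_transform[OF that, rotated]) (simp_all add: cut_off_def)
  then show ?thesis
    by (auto simp: de_rham_def cut_off_def vector_derivative_def fun_eq_iff)
qed

lemma has_vector_derivative_cut_off:
  assumes "(f has_vector_derivative D) (at r within {0<..\<epsilon>})" "r \<in> {0<..\<epsilon>}"
  shows "(cut_off \<epsilon> f has_vector_derivative D) (at r within {0<..\<epsilon>})"
  by (rule has_vector_derivative_transform[OF assms(2) _ assms(1)]) (simp add: cut_off_def)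

text \<open>For \<open>n = 0\<close> the truncated exponent \<open>n - 1\<close> is harmless because
  of the factor \<open>of_nat n\<close>.\<close>

lemma has_vector_derivative_log_power:
  assumes "r > 0"
  shows "((\<lambda>r. of_real (ln r) ^ n :: 'k::{real_normed_field,banach}) has_vector_derivative
    of_nat n * of_real (ln r) ^ (n - 1) / of_real r) (at r within S)"
proof -
  have "((\<lambda>r. ln r ^ n) has_field_derivative real n * ln r ^ (n - 1) / r) (at r within S)"
    using assms by (auto intro!: derivative_eq_intros simp: field_simps)
  from has_vector_derivative_of_real[OF this, where 'a = 'k] show ?thesis by simp
qed

lemma smooth_on_has_vector_derivative_within:
  assumes "\<And>x. x \<in> {0..\<epsilon>} \<Longrightarrow> (F has_vector_derivative F' x) (at x within {0..\<epsilon>})"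
    and "r \<in> {0<..\<epsilon>}"
  shows "(F has_vector_derivative F' r) (at r within {0<..\<epsilon>})"
  by (rule has_vector_derivative_within_subset[OF assms(1)]) (use assms(2) in auto)

lemma has_vector_derivative_mult_log_power:
  fixes F :: "real \<Rightarrow> 'k::{real_normed_field,banach}"
  assumes "\<And>x. x \<in> {0..\<epsilon>} \<Longrightarrow> (F has_vector_derivative F' x) (at x within {0..\<epsilon>})"
    and r: "r \<in> {0<..\<epsilon>}"
  shows "(cut_off \<epsilon> (\<lambda>r. F r * of_real (ln r) ^ n) has_vector_derivative
    F r * (of_nat n * of_real (ln r) ^ (n - 1) / of_real r) + F' r * of_real (ln r) ^ n)
    (at r within {0<..\<epsilon>})"
  using r
  by (intro has_vector_derivative_cut_off has_vector_derivative_mult has_vector_derivative_log_power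
      smooth_on_has_vector_derivative_within[OF assms(1)]) auto

lemma log_functions_deriv:
  assumes "f \<in> log_functions \<epsilon>"
  shows "\<exists>g\<in>log_functions \<epsilon>. \<forall>r\<in>{0<..\<epsilon>}.
    (f has_vector_derivative g r / of_real r) (at r within {0<..\<epsilon>})"
  using assms
proof (induction rule: log_functions_induct)
  case (monomial F n)
  obtain F' where F': "smooth_on {0..\<epsilon>} F'"
    and dF: "\<And>x. x \<in> {0..\<epsilon>} \<Longrightarrow> (F has_vector_derivative F' x) (at x within {0..\<epsilon>})"
    using smooth_on_deriv[OF monomial] by blast
  \<comment> \<open>The product rule multiplied by \<open>r\<close>: the logarithm contributes
    \<open>n F (ln r) ^ (n - 1)\<close> and the coefficient contributes
    \<open>r F' (ln r) ^ n\<close>, both with coefficients smooth up to 0.\<close>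
  let ?g = "cut_off \<epsilon> (\<lambda>r. (of_nat n * F r) * of_real (ln r) ^ (n - 1))
      + cut_off \<epsilon> (\<lambda>r. (r *\<^sub>R F' r) * of_real (ln r) ^ n)"
  have "?g \<in> log_functions \<epsilon>"
    by (intro log_functions_add log_functions_monomial smooth_on_ident_scaleR smooth_on_cmult monomial F')
  moreover have "(cut_off \<epsilon> (\<lambda>r. F r * of_real (ln r) ^ n) has_vector_derivative ?g r / of_real r)
      (at r within {0<..\<epsilon>})" if "r \<in> {0<..\<epsilon>}" for r
    using has_vector_derivative_mult_log_power[OF dF that, where n = n] that
    by (simp add: cut_off_simps field_simps scaleR_conv_of_real)
  ultimately show ?case by blast
next
  case (add f g)
  then obtain f' g' where "f' \<in> log_functions \<epsilon>" "g' \<in> log_functions \<epsilon>" and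
    "\<And>r. r \<in> {0<..\<epsilon>} \<Longrightarrow> (f has_vector_derivative f' r / of_real r) (at r within {0<..\<epsilon>})"
    "\<And>r. r \<in> {0<..\<epsilon>} \<Longrightarrow> (g has_vector_derivative g' r / of_real r) (at r within {0<..\<epsilon>})"
    by blast
  then show ?case
    by (intro bexI[of _ "f' + g'"] ballI log_functions_add has_vector_derivative_plus_divide)
qed

lemma log_functions_has_derivative:
  assumes "f \<in> log_functions \<epsilon>" "r \<in> {0<..\<epsilon>}"
  shows "(f has_vector_derivative de_rham \<epsilon> f r) (at r within {0<..\<epsilon>})"
proof -
  obtain g where g: "\<And>r. r\<in>{0<..\<epsilon>} \<Longrightarrow> (f has_vector_derivative g r / of_real r) (at r within {0<..\<epsilon>})"
    using log_functions_deriv[OF assms(1)] by blast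
  show ?thesis
    using g[OF assms(2)] de_rham_eqI[OF g] assms(2) by (simp add: cut_off_simps)
qed

lemma de_rham_in_log_one_forms:
  assumes "f \<in> log_functions \<epsilon>"
  shows "de_rham \<epsilon> f \<in> log_one_forms \<epsilon>"
proof -
  obtain g where g: "g \<in> log_functions \<epsilon>"
    "\<And>r. r\<in>{0<..\<epsilon>} \<Longrightarrow> (f has_vector_derivative g r / of_real r) (at r within {0<..\<epsilon>})"
    using log_functions_deriv[OF assms(1)] by blast
  have "de_rham \<epsilon> f = cut_off \<epsilon> (\<lambda>r. g r / of_real r)"
    by (intro de_rham_eqI g(2))
  then have "de_rham \<epsilon> f = (\<lambda>r. g r / of_real r)"
    using log_functions_outside[OF g(1)]
    by (auto simp: cut_off_def fun_eq_iff)
  with g(1) show ?thesis unfolding log_one_forms_def by blast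
qed

lemma de_rham_add:
  assumes "f \<in> log_functions \<epsilon>" "g \<in> log_functions \<epsilon>"
  shows "de_rham \<epsilon> (f + g) = de_rham \<epsilon> f + de_rham \<epsilon> g"
proof -
  have "de_rham \<epsilon> (f + g) = cut_off \<epsilon> (\<lambda>r. de_rham \<epsilon> f r + de_rham \<epsilon> g r)"
    unfolding func_plus
    by (intro de_rham_eqI has_vector_derivative_add log_functions_has_derivative assms)
  then show ?thesis by (auto simp: de_rham_def cut_off_def fun_eq_iff)
qed

lemma de_rham_cmult:
  assumes "f \<in> log_functions \<epsilon>"
  shows "de_rham \<epsilon> (\<lambda>r. c * f r) = (\<lambda>r. c * de_rham \<epsilon> f r)"
proof -
  have "de_rham \<epsilon> (\<lambda>r. c * f r) = cut_off \<epsilon> (\<lambda>r. c * de_rham \<epsilon> f r)"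
    by (intro de_rham_eqI has_vector_derivative_mult_right log_functions_has_derivative assms)
  then show ?thesis by (auto simp: de_rham_def cut_off_def fun_eq_iff)
qed

lemma de_rham_diff:
  assumes "f \<in> log_functions \<epsilon>" "g \<in> log_functions \<epsilon>"
  shows "de_rham \<epsilon> (f - g) = de_rham \<epsilon> f - de_rham \<epsilon> g"
  unfolding diff_eq_add_cmult using assms
  by (simp only: de_rham_add de_rham_cmult log_functions_cmult)

lemma de_rham_const: "de_rham \<epsilon> (\<lambda>_. c) = 0"
  using de_rham_eqI[of "\<lambda>_. c" "\<lambda>_. 0"] by (simp add: cut_off_def zero_fun_def)

lemma de_rham_0: "de_rham \<epsilon> 0 = 0"
  using de_rham_const[of 0] by (simp only: zero_fun_def)

lemma de_rham_eq_0D: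
  assumes "f \<in> log_functions \<epsilon>" "de_rham \<epsilon> f = 0"
  shows "f = cut_off \<epsilon> (\<lambda>_. Reg \<epsilon> l f)"
proof -
  have "(f has_vector_derivative 0) (at r within {0<..\<epsilon>})" if "r \<in> {0<..\<epsilon>}" for r
    using log_functions_has_derivative[OF assms(1) that] assms(2) by simp
  then obtain c where "\<And>r. r \<in> {0<..\<epsilon>} \<Longrightarrow> f r = c"
    using has_vector_derivative_zero_constant[OF convex_real_interval(6)[of 0 \<epsilon>]] by blast
  then have "f = cut_off \<epsilon> (\<lambda>_. c)"
    using log_functions_outside[OF assms(1)] by (auto simp: cut_off_def fun_eq_iff)
  then show ?thesis using Reg_smooth[OF smooth_on_const, of c] by simp
qed

section \<open>Primitives of logarithmic 1-forms\<close>

lemma exists_primitive_regular: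
  fixes G :: "real \<Rightarrow> 'k::{real_normed_field,banach}"
  assumes "smooth_on {0..\<epsilon>} G"
  shows "\<exists>f\<in>log_functions \<epsilon>. \<forall>r\<in>{0<..\<epsilon>}.
    (f has_vector_derivative G r * of_real (ln r) ^ n) (at r within {0<..\<epsilon>})"
  using assms
proof (induction n arbitrary: G)
  case 0
  have "cut_off \<epsilon> (\<lambda>r. r *\<^sub>R mean_integral G r) \<in> log_functions \<epsilon>"
    by (intro log_functions_smooth smooth_on_ident_scaleR smooth_on_mean_integral 0)
  moreover have "(cut_off \<epsilon> (\<lambda>r. r *\<^sub>R mean_integral G r) has_vector_derivative G r) (at r within {0<..\<epsilon>})"
    if "r \<in> {0<..\<epsilon>}" for r
    by (intro has_vector_derivative_cut_off that
        smooth_on_has_vector_derivative_within[OF has_vector_derivative_mean_integral[OF 0]])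
  ultimately show ?case unfolding power_0 mult_1_right by blast
next
  case (Suc n)
  \<comment> \<open>Integration by parts with the primitive \<open>r mean_integral G r\<close> of
    \<open>G\<close>: the factor \<open>r\<close> cancels the \<open>1/r\<close> from the logarithm
    and leaves the correction \<open>(n + 1) mean_integral G r (ln r) ^ n\<close>. Its coefficient
    is smooth but differs from \<open>G\<close>, which is why the induction is over all
    \<open>G\<close>.\<close>
  obtain h where h: "h \<in> log_functions \<epsilon>"
    "\<And>r. r \<in> {0<..\<epsilon>} \<Longrightarrow> (h has_vector_derivative
      (of_nat (Suc n) * mean_integral G r) * of_real (ln r) ^ n) (at r within {0<..\<epsilon>})"
    using Suc.IH[OF smooth_on_cmult[OF smooth_on_mean_integral[OF Suc.prems]]] by blast
  let ?f = "cut_off \<epsilon> (\<lambda>r. (r *\<^sub>R mean_integral G r) * of_real (ln r) ^ Suc n) - h"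
  have "?f \<in> log_functions \<epsilon>"
    by (intro log_functions_diff log_functions_monomial smooth_on_ident_scaleR
        smooth_on_mean_integral Suc.prems h(1))
  moreover have "(?f has_vector_derivative G r * of_real (ln r) ^ Suc n) (at r within {0<..\<epsilon>})"
    if "r \<in> {0<..\<epsilon>}" for r
  proof -
    have eq: "G r * of_real (ln r) ^ Suc n =
        (r *\<^sub>R mean_integral G r) * (of_nat (Suc n) * of_real (ln r) ^ (Suc n - 1) / of_real r) + G r * of_real (ln r) ^ Suc n
        - (of_nat (Suc n) * mean_integral G r) * of_real (ln r) ^ n"
      using that by (simp add: scaleR_conv_of_real del: of_nat_Suc)
    show ?thesis
      unfolding fun_diff_def
      by (rule has_vector_derivative_eq_rhs[OF _ eq[symmetric]])
        (intro has_vector_derivative_diff h(2)[OF that] has_vector_derivative_mult_log_power[OF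
            has_vector_derivative_mean_integral[OF Suc.prems] that])
  qed
  ultimately show ?case by blast
qed

lemma exists_primitive:
  assumes "g \<in> log_functions \<epsilon>"
  shows "\<exists>f\<in>log_functions \<epsilon>. \<forall>r\<in>{0<..\<epsilon>}.
    (f has_vector_derivative g r / of_real r) (at r within {0<..\<epsilon>})"
  using assms
proof (induction rule: log_functions_induct)
  case (monomial G n)
  obtain H where H: "smooth_on {0..\<epsilon>} H" "\<And>r. r \<in> {0..\<epsilon>} \<Longrightarrow> G r = G 0 + r *\<^sub>R H r"
    by (rule smooth_on_hadamard[OF monomial]) (rule that)
  obtain h where h: "h \<in> log_functions \<epsilon>"
    "\<And>r. r \<in> {0<..\<epsilon>} \<Longrightarrow> (h has_vector_derivative H r * of_real (ln r) ^ n) (at r within {0<..\<epsilon>})"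
    using exists_primitive_regular[OF H(1)] by blast
  \<comment> \<open>The singular part \<open>G 0 (ln r) ^ n dr/r\<close> integrates explicitly and
    raises the power of the logarithm by one; \<open>h\<close> handles the remainder, where the
    Hadamard factor \<open>r\<close> has cancelled the pole.\<close>
  let ?f = "cut_off \<epsilon> (\<lambda>r. (G 0 / of_nat (Suc n)) * of_real (ln r) ^ Suc n) + h"
  have "?f \<in> log_functions \<epsilon>"
    by (intro log_functions_add log_functions_monomial smooth_on_const h(1))
  moreover have "(?f has_vector_derivative cut_off \<epsilon> (\<lambda>r. G r * of_real (ln r) ^ n) r / of_real r)
      (at r within {0<..\<epsilon>})" if "r \<in> {0<..\<epsilon>}" for r
  proof -
    have "G r = G 0 + of_real r * H r"
      using H(2)[of r] that by (simp add: scaleR_conv_of_real)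
    \<comment> \<open>The summand with factor 0 is the derivative of the constant coefficient; it is
      kept so that the right-hand side has the form of the product rule.\<close>
    then have eq: "cut_off \<epsilon> (\<lambda>r. G r * of_real (ln r) ^ n) r / of_real r =
        ((G 0 / of_nat (Suc n)) * (of_nat (Suc n) * of_real (ln r) ^ (Suc n - 1) / of_real r)
        + 0 * of_real (ln r) ^ Suc n) + H r * of_real (ln r) ^ n"
      using that by (simp add: cut_off_simps add_divide_distrib distrib_right del: of_nat_Suc)
    show ?thesis
      unfolding eq func_plus
      by (intro has_vector_derivative_add h(2)[OF that] has_vector_derivative_mult_log_power[OF
            has_vector_derivative_const that])
  qed
  ultimately show ?case by blast
next
  case (add f g)
  then obtain f' g' where "f' \<in> log_functions \<epsilon>" "g' \<in> log_functions \<epsilon>" and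
    "\<And>r. r \<in> {0<..\<epsilon>} \<Longrightarrow> (f' has_vector_derivative f r / of_real r) (at r within {0<..\<epsilon>})"
    "\<And>r. r \<in> {0<..\<epsilon>} \<Longrightarrow> (g' has_vector_derivative g r / of_real r) (at r within {0<..\<epsilon>})"
    by blast
  then show ?case
    by (intro bexI[of _ "f' + g'"] ballI log_functions_add has_vector_derivative_plus_divide)
qed

text \<open>All logarithmic 1-forms are exact. Closure properties of 1-forms and existence of
  normalized primitives are thereby inherited from functions.\<close>

lemma log_one_forms_eq: "log_one_forms \<epsilon> = de_rham \<epsilon> ` log_functions \<epsilon>"
proof (intro equalityI subsetI)
  fix h :: "real \<Rightarrow> 'a" assume "h \<in> log_one_forms \<epsilon>"
  then obtain g where g: "g \<in> log_functions \<epsilon>" "h = (\<lambda>r. g r / of_real r)"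
    unfolding log_one_forms_def by blast
  obtain f where f: "f \<in> log_functions \<epsilon>"
    "\<And>r. r \<in> {0<..\<epsilon>} \<Longrightarrow> (f has_vector_derivative g r / of_real r) (at r within {0<..\<epsilon>})"
    using exists_primitive[OF g(1)] by blast
  have "de_rham \<epsilon> f = cut_off \<epsilon> (\<lambda>r. g r / of_real r)"
    by (intro de_rham_eqI f(2))
  then have "de_rham \<epsilon> f = h"
    unfolding g(2) using log_functions_outside[OF g(1)]
    by (auto simp: cut_off_def fun_eq_iff)
  with f(1) show "h \<in> de_rham \<epsilon> ` log_functions \<epsilon>" by blast
qed (auto intro: de_rham_in_log_one_forms)

lemma primitive_eqI:
  fixes f h :: "real \<Rightarrow> 'k::{real_normed_field,banach}"
  assumes "f \<in> log_functions \<epsilon>" "de_rham \<epsilon> f = h" "Reg \<epsilon> l f = 0"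
  shows "primitive \<epsilon> l h = f"
  unfolding primitive_def
proof (rule the_equality)
  fix g assume g: "g \<in> log_functions \<epsilon> \<and> de_rham \<epsilon> g = h \<and> Reg \<epsilon> l g = 0"
  then have "g - f = cut_off \<epsilon> (\<lambda>_. Reg \<epsilon> l (g - f))"
    using assms by (intro de_rham_eq_0D) (simp_all only: log_functions_diff de_rham_diff diff_self)
  also have "Reg \<epsilon> l (g - f) = 0"
    using g assms by (simp add: Reg_diff)
  also have "cut_off \<epsilon> (\<lambda>_. 0) = (0 :: real \<Rightarrow> 'k)"
    by (simp add: cut_off_def zero_fun_def)
  finally show "g = f" by (simp only: right_minus_eq)
qed (intro conjI assms)

text \<open>Subtracting the constant with the same regularized value normalizes any primitive. By
  exactness this computes \<open>primitive\<close> on all 1-forms, and it is the source of the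
  homotopy identity on functions.\<close>

lemma primitive_de_rham:
  assumes f: "f \<in> log_functions \<epsilon>"
  shows "primitive \<epsilon> l (de_rham \<epsilon> f) = f - cut_off \<epsilon> (\<lambda>_. Reg \<epsilon> l f)"
  by (rule primitive_eqI)
    (simp_all only: f log_functions_diff log_functions_smooth smooth_on_const de_rham_diff de_rham_cut_off
      de_rham_const Reg_diff Reg_smooth diff_self diff_zero)

lemma primitive_works:
  assumes "h \<in> log_one_forms \<epsilon>"
  shows "primitive \<epsilon> l h \<in> log_functions \<epsilon>" "de_rham \<epsilon> (primitive \<epsilon> l h) = h"
    "Reg \<epsilon> l (primitive \<epsilon> l h) = 0"
proof -
  obtain f where f: "f \<in> log_functions \<epsilon>" "h = de_rham \<epsilon> f"
    using assms unfolding log_one_forms_eq by blast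
  show "primitive \<epsilon> l h \<in> log_functions \<epsilon>" "de_rham \<epsilon> (primitive \<epsilon> l h) = h"
    "Reg \<epsilon> l (primitive \<epsilon> l h) = 0"
    unfolding f(2) primitive_de_rham[OF f(1)]
    by (simp_all only: f log_functions_diff log_functions_smooth smooth_on_const de_rham_diff de_rham_cut_off
      de_rham_const Reg_diff Reg_smooth diff_self diff_zero)
qed

lemma log_one_forms_add: "g \<in> log_one_forms \<epsilon> \<Longrightarrow> h \<in> log_one_forms \<epsilon> \<Longrightarrow> g + h \<in> log_one_forms \<epsilon>"
  unfolding log_one_forms_eq by (elim imageE) (simp only: de_rham_add[symmetric] log_functions_add imageI)

lemma log_one_forms_cmult: "h \<in> log_one_forms \<epsilon> \<Longrightarrow> (\<lambda>r. c * h r) \<in> log_one_forms \<epsilon>"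
  unfolding log_one_forms_eq by (elim imageE) (simp only: de_rham_cmult[symmetric] log_functions_cmult imageI)

lemma primitive_add:
  assumes "g \<in> log_one_forms \<epsilon>" "h \<in> log_one_forms \<epsilon>"
  shows "primitive \<epsilon> l (g + h) = primitive \<epsilon> l g + primitive \<epsilon> l h"
  by (rule primitive_eqI)
    (simp_all only: assms primitive_works log_functions_add de_rham_add Reg_add add_0)

lemma primitive_cmult:
  assumes "h \<in> log_one_forms \<epsilon>"
  shows "primitive \<epsilon> l (\<lambda>r. c * h r) = (\<lambda>r. c * primitive \<epsilon> l h r)"
  by (rule primitive_eqI)
    (simp_all only: assms primitive_works log_functions_cmult de_rham_cmult Reg_cmult mult_zero_right)

lemma primitive_0: "primitive \<epsilon> l 0 = 0"
  using de_rham_const[of 0] by (intro primitive_eqI log_functions_0 Reg_0) (simp only: zero_fun_def)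

section \<open>The complex of logarithmic forms\<close>

text \<open>A uniform description of all degrees: both components are always admissible, and only
  their vanishing depends on \<open>n\<close>. Later arguments then treat a pair
  \<open>(f, h)\<close> at once instead of splitting by degree.\<close>

lemma grade_log_formsD:
  assumes "x \<in> grade (log_forms \<epsilon>) n"
  obtains f h where "x = (f, h)" "f \<in> log_functions \<epsilon>" "h \<in> log_one_forms \<epsilon>"
    "n \<noteq> 0 \<Longrightarrow> f = 0" "n \<noteq> 1 \<Longrightarrow> h = 0"
proof -
  have "(0 :: real \<Rightarrow> 'a) \<in> log_one_forms \<epsilon>"
    using de_rham_in_log_one_forms[OF log_functions_0] by (simp only: de_rham_0)
  then show ?thesis
    using assms log_functions_0[of \<epsilon>] that
    by (auto simp: log_forms_def zero_prod_def split: if_splits)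
qed

lemma grade_log_formsI:
  assumes "f \<in> log_functions \<epsilon>" "h \<in> log_one_forms \<epsilon>" "n \<noteq> 0 \<Longrightarrow> f = 0" "n \<noteq> 1 \<Longrightarrow> h = 0"
  shows "(f, h) \<in> grade (log_forms \<epsilon>) n"
  using assms by (auto simp: log_forms_def zero_prod_def)

lemma log_one_forms_0: "0 \<in> log_one_forms \<epsilon>"
  using grade_log_formsD[of 0 2] by (auto simp: log_forms_def zero_prod_def)

lemma scl_log_forms: "scl (log_forms \<epsilon>) c (f, h) = (\<lambda>r. c * f r, \<lambda>r. c * h r)"
  and diff_log_forms: "diff (log_forms \<epsilon>) (f, h) = (0, de_rham \<epsilon> f)"
  by (simp_all add: log_forms_def)

lemma cmult_zero_fun: "(\<lambda>r. c * (0 :: 'a \<Rightarrow> 'b::mult_zero) r) = 0"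
  by (simp add: zero_fun_def)

lemma is_cochain_complex_log_forms:
  "is_cochain_complex (log_forms \<epsilon> :: ('k::{real_normed_field,banach}, _) cochain_complex)"
proof -
  have vs: "vector_space (scl (log_forms \<epsilon> :: ('k::{real_normed_field,banach}, _) cochain_complex))"
    by unfold_locales (auto simp: scl_log_forms plus_fun_def algebra_simps)
  interpret vector_space "scl (log_forms \<epsilon> :: ('k::{real_normed_field,banach}, _) cochain_complex)"
    by (rule vs)
  have sub: "subspace (grade (log_forms \<epsilon> :: ('k, _) cochain_complex) n)" for n
  proof (rule subspaceI)
    show "0 \<in> grade (log_forms \<epsilon> :: ('k, _) cochain_complex) n"
      unfolding zero_prod_def by (intro grade_log_formsI log_functions_0 log_one_forms_0 refl)
    fix x y :: "(real \<Rightarrow> 'k) \<times> (real \<Rightarrow> 'k)" and c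
    assume x: "x \<in> grade (log_forms \<epsilon>) n"
    show "scl (log_forms \<epsilon>) c x \<in> grade (log_forms \<epsilon>) n"
      by (rule grade_log_formsD[OF x])
        (auto simp: scl_log_forms cmult_zero_fun intro!: grade_log_formsI log_functions_cmult log_one_forms_cmult)
    assume y: "y \<in> grade (log_forms \<epsilon>) n"
    show "x + y \<in> grade (log_forms \<epsilon>) n"
      by (rule grade_log_formsD[OF x], rule grade_log_formsD[OF y])
        (auto intro!: grade_log_formsI log_functions_add log_one_forms_add)
  qed
  have "graded_linear 1 (log_forms \<epsilon>) (log_forms \<epsilon> :: ('k, _) cochain_complex) (diff (log_forms \<epsilon>))"
    unfolding graded_linear_def
  proof (intro conjI allI ballI)
    fix x y :: "(real \<Rightarrow> 'k) \<times> (real \<Rightarrow> 'k)" and c n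
    assume x: "x \<in> grade (log_forms \<epsilon>) n"
    show "diff (log_forms \<epsilon>) x \<in> grade (log_forms \<epsilon>) (n + 1)"
      by (rule grade_log_formsD[OF x])
        (auto simp: diff_log_forms de_rham_0 intro!: grade_log_formsI log_functions_0 de_rham_in_log_one_forms)
    show "diff (log_forms \<epsilon>) (scl (log_forms \<epsilon>) c x) = scl (log_forms \<epsilon>) c (diff (log_forms \<epsilon>) x)"
      by (rule grade_log_formsD[OF x])
        (simp only: diff_log_forms scl_log_forms de_rham_cmult cmult_zero_fun)
    assume y: "y \<in> grade (log_forms \<epsilon>) n"
    show "diff (log_forms \<epsilon>) (x + y) = diff (log_forms \<epsilon>) x + diff (log_forms \<epsilon>) y"
      by (rule grade_log_formsD[OF x], rule grade_log_formsD[OF y])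
        (simp only: diff_log_forms add_Pair de_rham_add add_0)
  qed
  moreover have "diff (log_forms \<epsilon>) (diff (log_forms \<epsilon>) x) = 0" for x :: "(real \<Rightarrow> 'k) \<times> (real \<Rightarrow> 'k)"
    by (cases x) (simp only: diff_log_forms de_rham_0 zero_prod_def)
  ultimately show ?thesis
    unfolding is_cochain_complex_def using vs sub by blast
qed

end

section \<open>Cochains of the interval and restriction to endpoints\<close>

lemma is_cochain_complex_interval_cochains:
  "is_cochain_complex (interval_cochains :: ('k::field, _) cochain_complex)"
proof -
  have vs: "vector_space (scl (interval_cochains :: ('k::field, _) cochain_complex))"
    by unfold_locales (auto simp: interval_cochains_def algebra_simps)
  interpret vector_space "scl (interval_cochains :: ('k::field, _) cochain_complex)"
    by (rule vs)
  have "subspace (grade (interval_cochains :: ('k, _) cochain_complex) n)" for n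
    by (rule subspaceI) (auto simp: interval_cochains_def zero_prod_def split: if_splits)
  moreover have "graded_linear 1 interval_cochains (interval_cochains :: ('k, _) cochain_complex) (diff interval_cochains)"
    by (auto simp: graded_linear_def interval_cochains_def zero_prod_def algebra_simps split: if_splits)
  moreover have "diff interval_cochains (diff interval_cochains s) = 0" for s :: "('k \<times> 'k) \<times> 'k"
    by (auto simp: interval_cochains_def zero_prod_def split_beta)
  ultimately show ?thesis
    unfolding is_cochain_complex_def using vs by blast
qed

text \<open>Since \<open>p i = id\<close> and \<open>p K = 0\<close>, only the identity \<open>e p = e'\<close> has to be checked.\<close>

lemma commutes_with_endpoint_factor:
  assumes sdr: "special_deformation_retract S A i p K" and e: "chain_map S point_complex e"
    and e': "\<And>x. e (p x) = e' x"
  shows "commutes_with_endpoint S A i p K e e'"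
proof -
  have p: "chain_map A S p" and K: "graded_linear (-1) A A K"
    and pi: "\<And>n s. s \<in> grade S n \<Longrightarrow> p (i s) = s" and pK: "\<And>n x. x \<in> grade A n \<Longrightarrow> p (K x) = 0"
    using sdr unfolding special_deformation_retract_def by blast+
  have p_gr: "p x \<in> grade S n" if "x \<in> grade A n" for x n
    using p that unfolding chain_map_def graded_linear_def add_0_right by blast
  have "chain_map A point_complex (\<lambda>x. e (p x))"
    using p e p_gr unfolding chain_map_def graded_linear_def add_0_right by (simp only: Ball_def) metis
  then have "chain_map A point_complex e'"
    by (simp only: e')
  moreover have "e' (i s) = e s" if "s \<in> grade S n" for s n
    using pi[OF that] e'[of "i s"] by simp
  moreover have "e' (K x) = 0" if "x \<in> grade A n" for x n
  proof -
    \<comment> \<open>Additivity of \<open>e\<close> is known only on homogeneous elements, so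
      \<open>e 0 = 0\<close> needs a degree containing 0; the element \<open>p (K x)\<close>
      supplies one.\<close>
    have "K x \<in> grade A (n + - 1)"
      using K that unfolding graded_linear_def by blast
    from p_gr[OF this] have "0 \<in> grade S (n + - 1)"
      by (simp only: pK[OF that])
    then have "e (0 + 0) = e 0 + e 0"
      using e unfolding chain_map_def graded_linear_def by blast
    then have "e 0 = 0"
      unfolding add_0_right by (simp only: add_cancel_right_right)
    then show ?thesis using e'[of "K x"] pK[OF that] by simp
  qed
  ultimately show ?thesis
    using e e' unfolding commutes_with_endpoint_def retract_morphism_def id_apply by blast
qed

section \<open>The retract identities\<close>

theorem proposition13p6:
  fixes \<epsilon> l :: real and chi :: "real \<Rightarrow> real"
    and i :: "('k::{real_normed_field,banach} \<times> 'k) \<times> 'k \<Rightarrow> (real \<Rightarrow> 'k) \<times> (real \<Rightarrow> 'k)"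
    and p :: "(real \<Rightarrow> 'k) \<times> (real \<Rightarrow> 'k) \<Rightarrow> ('k \<times> 'k) \<times> 'k"
    and K :: "(real \<Rightarrow> 'k) \<times> (real \<Rightarrow> 'k) \<Rightarrow> (real \<Rightarrow> 'k) \<times> (real \<Rightarrow> 'k)"
  assumes "\<epsilon> > 0" and "l > 0"
    and "smooth_on {0..\<epsilon>} chi" and "chi ` {0..\<epsilon>} \<subseteq> {0..1}" and "chi 0 = 0" and "chi \<epsilon> = 1"
  defines "i \<equiv> retract_i \<epsilon> chi" and "p \<equiv> retract_p \<epsilon> l" and "K \<equiv> retract_K \<epsilon> l chi"
  shows "special_deformation_retract interval_cochains (log_forms \<epsilon>) i p K \<and>
    commutes_with_endpoint interval_cochains (log_forms \<epsilon>) i p K cochain_at_0 (log_reg_0 \<epsilon> l) \<and>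
    commutes_with_endpoint interval_cochains (log_forms \<epsilon>) i p K cochain_at_1 (log_eval_end \<epsilon>)"
proof -
  let ?A = "log_forms \<epsilon> :: ('k, _) cochain_complex" and ?S = "interval_cochains :: ('k, _) cochain_complex"
  note eps = \<open>\<epsilon> > 0\<close>
  \<comment> \<open>\<open>X\<close> and \<open>U\<close> are the logarithmic functions given by
    \<open>chi\<close> and by the constant 1. All three maps are expressed through them, so the
    boundary conditions on \<open>chi\<close> enter only through
    \<open>Reg \<epsilon> l X = 0\<close> and \<open>X \<epsilon> = 1\<close>.\<close>
  define X :: "real \<Rightarrow> 'k" where "X = cut_off \<epsilon> (\<lambda>r. of_real (chi r))"
  define U :: "real \<Rightarrow> 'k" where "U = cut_off \<epsilon> (\<lambda>_. 1)"
  define dX where "dX = de_rham \<epsilon> X"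
  have chi: "smooth_on {0..\<epsilon>} (\<lambda>r. of_real (chi r) :: 'k)"
    by (rule smooth_on_of_real[OF assms(3)])
  have X: "X \<in> log_functions \<epsilon>" "Reg \<epsilon> l X = 0" "X \<epsilon> = 1"
    unfolding X_def using Reg_smooth[OF eps chi] log_functions_smooth[OF chi] assms
    by (simp_all add: cut_off_def)
  have U: "U \<in> log_functions \<epsilon>" "Reg \<epsilon> l U = 1" "U \<epsilon> = 1" "de_rham \<epsilon> U = 0"
    unfolding U_def using Reg_smooth[OF eps smooth_on_const] log_functions_smooth[OF smooth_on_const] assms
    by (simp_all add: cut_off_simps de_rham_cut_off[OF eps] de_rham_const[OF eps])
  have dX: "dX \<in> log_one_forms \<epsilon>"
    unfolding dX_def by (rule de_rham_in_log_one_forms[OF eps X(1)])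
  have i: "i ((a0, a1), a) = ((\<lambda>r. a0 * U r) + (\<lambda>r. (a1 - a0) * X r), \<lambda>r. a * dX r)" for a0 a1 a
    unfolding i_def retract_i_def dX_def X_def U_def de_rham_cut_off[OF eps]
    by (auto simp: fun_eq_iff cut_off_def algebra_simps)
  have p: "p (f, h) = ((Reg \<epsilon> l f, f \<epsilon>), primitive \<epsilon> l h \<epsilon>)" for f h
    by (simp add: p_def retract_p_def reg_integral_def)
  have K: "K (f, h) = (primitive \<epsilon> l h - (\<lambda>r. primitive \<epsilon> l h \<epsilon> * X r), 0)" for f h
    by (auto simp: K_def retract_K_def reg_integral_def X_def cut_off_def fun_eq_iff)
  \<comment> \<open>Since \<open>chi\<close> vanishes at 0, \<open>X\<close> is already the
    normalized primitive of its differential.\<close>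
  have primX: "primitive \<epsilon> l (\<lambda>r. a * dX r) = (\<lambda>r. a * X r)" for a
    by (rule primitive_eqI[OF eps])
      (simp_all only: X log_functions_cmult de_rham_cmult[OF eps] Reg_cmult[OF eps] dX_def mult_zero_right)
  have prim_d: "primitive \<epsilon> l (de_rham \<epsilon> f) = f - (\<lambda>r. Reg \<epsilon> l f * U r)" if "f \<in> log_functions \<epsilon>" for f :: "real \<Rightarrow> 'k"
    unfolding primitive_de_rham[OF eps that] by (auto simp: U_def cut_off_def fun_eq_iff)
  \<comment> \<open>\<open>L\<close> collects membership facts and \<open>R\<close> computation
    rules; since the rules in \<open>R\<close> have membership premises, the two are mostly used
    together.\<close>
  note L = log_functions_add log_functions_cmult log_functions_diff log_functions_0 X(1) U(1) primitive_works[OF eps]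
    log_one_forms_add[OF eps] log_one_forms_cmult[OF eps] log_one_forms_0[OF eps] dX de_rham_in_log_one_forms[OF eps]
  note R = Reg_add[OF eps] Reg_cmult[OF eps] Reg_diff[OF eps] Reg_0[OF eps] X(2,3) U(2-4)
    de_rham_add[OF eps] de_rham_cmult[OF eps] de_rham_diff[OF eps] de_rham_0[OF eps] dX_def[symmetric]
    primitive_add[OF eps] primitive_cmult[OF eps] primitive_0[OF eps] primX prim_d
  have S_diff: "diff ?S ((a0, a1), a) = ((0, 0), a1 - a0)"
    and S_scl: "scl ?S c ((a0, a1), a) = ((c * a0, c * a1), c * a)" for a0 a1 a c
    by (simp_all add: interval_cochains_def zero_prod_def)
  have S_D: "\<exists>a0 a1 a. s = ((a0, a1), a) \<and> (n \<noteq> 0 \<longrightarrow> a0 = 0 \<and> a1 = 0) \<and> (n \<noteq> 1 \<longrightarrow> a = 0)"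
    if "s \<in> grade ?S n" for s n
    using that by (cases s) (auto simp: interval_cochains_def zero_prod_def split: if_splits)
  have S_I: "((a0, a1), a) \<in> grade ?S n"
    if "n \<noteq> 0 \<Longrightarrow> a0 = 0 \<and> a1 = 0" "n \<noteq> 1 \<Longrightarrow> a = 0" for a0 a1 a n
    using that by (auto simp: interval_cochains_def zero_prod_def)
  have A_cases: thesis if "x \<in> grade ?A n"
    and "\<And>f h. x = (f, h) \<Longrightarrow> f \<in> log_functions \<epsilon> \<Longrightarrow> h \<in> log_one_forms \<epsilon> \<Longrightarrow>
      (n \<noteq> 0 \<Longrightarrow> f = 0) \<Longrightarrow> (n \<noteq> 1 \<Longrightarrow> h = 0) \<Longrightarrow> thesis" for x n thesis
    using grade_log_formsD[OF eps that(1)] that(2) by metis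
  have chain_i: "chain_map ?S ?A i"
    unfolding chain_map_def graded_linear_def
  proof (intro conjI allI ballI)
    fix s t :: "('k \<times> 'k) \<times> 'k" and c n
    assume s: "s \<in> grade ?S n"
    obtain a0 a1 a where sa: "s = ((a0, a1), a)" "n \<noteq> 0 \<Longrightarrow> a0 = 0 \<and> a1 = 0" "n \<noteq> 1 \<Longrightarrow> a = 0"
      using S_D[OF s] by blast
    show "i s \<in> grade ?A (n + 0)"
      unfolding sa(1) i add_0_right
      by (intro grade_log_formsI[OF eps] L) (auto dest: sa(2,3) simp: fun_eq_iff)
    show "i (scl ?S c s) = scl ?A c (i s)"
      unfolding sa(1) i S_scl scl_log_forms[OF eps] by (simp add: fun_eq_iff algebra_simps)
    show "diff ?A (i s) = i (diff ?S s)"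
      unfolding sa(1) i S_diff diff_log_forms[OF eps]
      by (simp only: R L) (simp add: fun_eq_iff)
    assume t: "t \<in> grade ?S n"
    show "i (s + t) = i s + i t"
      unfolding sa(1) by (cases t) (auto simp: i fun_eq_iff algebra_simps)
  qed
  have chain_p: "chain_map ?A ?S p"
    unfolding chain_map_def graded_linear_def
  proof (intro conjI allI ballI)
    fix x y :: "(real \<Rightarrow> 'k) \<times> (real \<Rightarrow> 'k)" and c n
    assume x: "x \<in> grade ?A n"
    show "p x \<in> grade ?S (n + 0)"
      using x by (rule A_cases) (auto simp: p R intro!: S_I)
    show "p (scl ?A c x) = scl ?S c (p x)"
      using x by (rule A_cases) (simp only: scl_log_forms[OF eps] S_scl p R)
    show "diff ?S (p x) = p (diff ?A x)"
      using x by (rule A_cases) (simp only: diff_log_forms[OF eps] S_diff p R, simp add: R)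
    assume y: "y \<in> grade ?A n"
    show "p (x + y) = p x + p y"
      by (rule A_cases[OF x], rule A_cases[OF y]) (simp only: add_Pair p R plus_fun_apply)
  qed
  have lin_K: "graded_linear (-1) ?A ?A K"
    unfolding graded_linear_def
  proof (intro conjI allI ballI)
    fix x y :: "(real \<Rightarrow> 'k) \<times> (real \<Rightarrow> 'k)" and c n
    assume x: "x \<in> grade ?A n"
    show "K x \<in> grade ?A (n + - 1)"
      using x
    proof (rule A_cases)
      fix f h assume *: "x = (f, h)" "h \<in> log_one_forms \<epsilon>" "n \<noteq> 1 \<Longrightarrow> h = 0"
      have "primitive \<epsilon> l h - (\<lambda>r. primitive \<epsilon> l h \<epsilon> * X r) = 0" if "n + - 1 \<noteq> 0"
      proof -
        from *(3) that have "h = 0" by simp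
        then show ?thesis by (simp only: R) (simp add: fun_eq_iff)
      qed
      then show "K x \<in> grade ?A (n + - 1)"
        unfolding *(1) K by (intro grade_log_formsI[OF eps] L *(2)) auto
    qed
    show "K (scl ?A c x) = scl ?A c (K x)"
      using x by (rule A_cases) (simp only: scl_log_forms[OF eps] K R, simp add: fun_eq_iff algebra_simps)
    assume y: "y \<in> grade ?A n"
    show "K (x + y) = K x + K y"
      by (rule A_cases[OF x], rule A_cases[OF y])
        (simp only: add_Pair K R plus_fun_apply, simp add: fun_eq_iff algebra_simps)
  qed
  \<comment> \<open>The function part has regularized value \<open>a0\<close> at 0 and value
    \<open>a0 + (a1 - a0) = a1\<close> at \<epsilon>; the form \<open>a dX\<close> has normalized
    primitive \<open>a X\<close>, hence regularized integral \<open>a\<close>.\<close>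
  have pi: "p (i s) = s" for s
  proof -
    obtain a0 a1 a where s: "s = ((a0, a1), a)" by (metis surj_pair)
    show ?thesis unfolding s i p by (simp only: R L plus_fun_apply, simp add: R)
  qed
  \<comment> \<open>On functions, \<open>K\<close> applied to the differential gives
    \<open>f - Reg f U - (f \<epsilon> - Reg f) X\<close>, which is \<open>f - i (p f)\<close>. On
    1-forms, differentiating \<open>K h\<close> gives \<open>h\<close> minus its regularized
    integral times \<open>dX\<close>.\<close>
  have homotopy: "diff ?A (K x) + K (diff ?A x) = x - i (p x)" if "x \<in> grade ?A n" for x n
    using that
    by (rule A_cases) (simp only: diff_log_forms[OF eps] K i p R L add_Pair diff_Pair,
        simp add: R fun_eq_iff algebra_simps)
  \<comment> \<open>\<open>K\<close> reads only the form component and returns a pair whose form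
    component is 0.\<close>
  have KK: "K (K x) = 0" for x
    by (cases x) (simp only: K R, simp add: fun_eq_iff zero_prod_def)
  \<comment> \<open>Both terms of \<open>K h\<close> have regularized value 0, and they cancel at
    \<epsilon> because \<open>X \<epsilon> = 1\<close>.\<close>
  have pK: "p (K x) = 0" if "x \<in> grade ?A n" for x n
    using that by (rule A_cases) (simp only: K p R L, simp add: R L zero_prod_def)
  \<comment> \<open>By \<open>primX\<close> the normalized primitive of \<open>a dX\<close> is
    \<open>a X\<close>, which is precisely the multiple of \<open>X\<close> that \<open>K\<close>
    subtracts.\<close>
  have Ki: "K (i s) = 0" for s
  proof -
    obtain a0 a1 a where s: "s = ((a0, a1), a)" by (metis surj_pair)
    show ?thesis unfolding s i K by (simp only: R L, simp add: R fun_eq_iff zero_prod_def)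
  qed
  have sdr: "special_deformation_retract ?S ?A i p K"
    unfolding special_deformation_retract_def
    using is_cochain_complex_interval_cochains is_cochain_complex_log_forms[OF eps]
      chain_i chain_p lin_K pi homotopy KK pK Ki by blast
  have ends: "chain_map ?S point_complex cochain_at_0" "chain_map ?S point_complex cochain_at_1"
    by (auto simp: chain_map_def graded_linear_def interval_cochains_def point_complex_def
        cochain_at_0_def cochain_at_1_def zero_prod_def split: if_splits)
  have "commutes_with_endpoint ?S ?A i p K cochain_at_0 (log_reg_0 \<epsilon> l)"
    by (rule commutes_with_endpoint_factor[OF sdr ends(1)])
      (auto simp: p cochain_at_0_def log_reg_0_def)
  moreover have "commutes_with_endpoint ?S ?A i p K cochain_at_1 (log_eval_end \<epsilon>)"
    by (rule commutes_with_endpoint_factor[OF sdr ends(2)])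
      (auto simp: p cochain_at_1_def log_eval_end_def)
  ultimately show ?thesis
    using sdr by blast
qed

end
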